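(* Let the partition function $$Z:=\sum_{n=0}^\infty\prod_{k=1}^ng_k^{-1},$$ with $g_k$ given by the jump rates of the totally asymmetric headway exclusion process (TAHEP), be finite. Then the TAHEP $\mathbf{x}(t)$ with $N$ particles on $\mathbb{Z}$ and starting with the leftmost particle on site $x^\ast\in\mathbb{Z}$ is reversely dual to a single totally asymmetric random walk $x(t)$ with jumps to the left (at rate $w$) and starting at $x^\ast$, with respect to the duality function $$R(x,\mathbf{x})=\frac{\delta_{x_1,x}}{Z^{N-1}}\prod_{i=1}^{N-1}\ \prod_{k=1}^{x_{i+1}-x_i-1}g_k^{-1}$$ for $\mathbf{x}=(x_1,\dots,x_N)\in\Omega^*_N$ and integers $x\le x^\ast$.
   Context: $N\in\mathbb{N}=\{1,2,\dots\}$, and $\Omega^*_N$ is the countable set of configurations of $N$ exclusion particles on $\mathbb{Z}$, written as $\mathbf{x}=(x_1,\dots,x_N)$ with integers $x_1<x_2<\dots<x_N$. The headway of particle $i$ is $n_i=x_{i+1}-x_i-1$ for $i<N$, and $n_N=\infty$. Let $J$ be an interaction potential, $J(0)=\infty$ and $J(n)\in\mathbb{R}\cup\{\infty\}$ for $n\in\mathbb{N}$, let $y_0=0$, $y_k=e^{-J(k)}$ for $k\ge1$, and $g_k=y_k/y_{k+1}$, so that $g_0=0$ and $g_k=e^{J(k+1)-J(k)}$ for $k\ge1$. Let $w>0$. The TAHEP with $N$ particles on $\mathbb{Z}$ considered here is the continuous-time Markov chain on $\Omega^*_N$ in which each particle $i$ jumps from $x_i$ to $x_i+1$ at rate $w\,g_{n_i}$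 if $n_i<\infty$ (so there is no jump to an occupied site), and the rightmost particle, whose headway is $\infty$, jumps to the right at rate $w$. The dual walk is the space-reflected one-particle TAHEP on $\mathbb{Z}$ starting from $x^\ast$, i.e. the totally asymmetric simple random walk that jumps from $x$ to $x-1$ at rate $w$, with intensity matrix $\tilde Q_{x,y}=w(\delta_{y,x-1}-\delta_{y,x})$ for integers $x\le x^\ast$, $y\le x^\ast$. Reverse duality: let $\omega(t)$ and $\tilde\omega(t)$ be Markov chains with countable state spaces $\Omega$ and $\tilde\Omega$, and let $R:\tilde\Omega\times\Omega\to\mathbb{R}$ be summable over $\tilde\omega\in\tilde\Omega$ for every $\omega$ and summable over $\omega\in\Omega$ for every $\tilde\omega$. The processes are called reversely dual to one another with respect to the duality function $R$ if for all $t\ge0$, all $\omega\in\Omega$ and all $\tilde\omega\in\tilde\Omega$ $$\sum_{\omega'\in\Omega}R(\tilde\omega,\omega')\,\mathbf{P}^{\omega'}(\omega(t)=\omega)=\sum_{\tilde\omega'\in\tilde\Omega}R(\tilde\omega',\omega)\,\mathbf{P}^{\tilde\omega'}(\tilde\omega(t)=\tilde\omega),$$ where $\mathbf{P}^{\omega'}$ denotes the law of the chain started from $\omega'$. Empty products equal $1$; $\delta$ is the Kronecker delta.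
   Formalization: For the walk on integers x ≤ x*, the duality relation is stated only for configurations with x_1 ≤ x* (it fails for x_1 > x*, t > 0); full reverse duality is also stated for the walk on all of Z. All g_k are assumed finite so that the jump rates are real. *)

theory Defs
  imports "HOL-Probability.Probability"
begin

section \<open>Continuous-time Markov chains on countable state spaces\<close>

definition trans_prob ::
    "('s \<Rightarrow> 'w measure) \<Rightarrow> (real \<Rightarrow> 'w \<Rightarrow> 's) \<Rightarrow> real \<Rightarrow> 's \<Rightarrow> 's \<Rightarrow> real" where
  "trans_prob P X t x y = measure (P x) {\<omega> \<in> space (P x). X t \<omega> = y}"

text \<open>
  \<open>P x\<close> is the law of the chain started in \<open>x\<close>, and \<open>Q\<close> is the intensity matrix, of which
  only the entries in \<open>S \<times> S\<close> matter. Since \<open>X t\<close> takes its values in \<open>S\<close> for every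
  \<open>t \<ge> 0\<close>, the chain has no cemetery state. Regularity of the sample paths is not
  demanded, since reverse duality only involves one-dimensional marginals.
\<close>

locale ctmc =
  fixes S :: "'s set"
    and Q :: "'s \<Rightarrow> 's \<Rightarrow> real"
    and P :: "'s \<Rightarrow> 'w measure"
    and X :: "real \<Rightarrow> 'w \<Rightarrow> 's"
  assumes countable_states: "countable S"
    and prob_space: "x \<in> S \<Longrightarrow> prob_space (P x)"
    and random_variable: "x \<in> S \<Longrightarrow> 0 \<le> t \<Longrightarrow> X t \<in> measurable (P x) (count_space S)"
    and initial: "x \<in> S \<Longrightarrow> AE \<omega> in P x. X 0 \<omega> = x"
    and markov: "\<And>x y s (n :: nat) \<tau> \<xi>.
        \<lbrakk>x \<in> S; y \<in> S; 0 \<le> s; 0 \<le> \<tau> 0; mono_on {..n} \<tau>; \<And>i. i \<le> n \<Longrightarrow> \<xi> i \<in> S\<rbrakk> \<Longrightarrow>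
          measure (P x) {\<omega> \<in> space (P x). (\<forall>i\<le>n. X (\<tau> i) \<omega> = \<xi> i) \<and> X (\<tau> n + s) \<omega> = y}
        = measure (P x) {\<omega> \<in> space (P x). \<forall>i\<le>n. X (\<tau> i) \<omega> = \<xi> i} * trans_prob P X s (\<xi> n) y"
    and intensity: "\<lbrakk>x \<in> S; y \<in> S\<rbrakk> \<Longrightarrow>
        ((\<lambda>h. (trans_prob P X h x y - of_bool (x = y)) / h) \<longlongrightarrow> Q x y) (at_right 0)"

section \<open>Reverse duality\<close>

text \<open>
  In both definitions \<open>p t a b\<close> is the probability to be in \<open>b\<close> at time \<open>t\<close> when started in
  \<open>a\<close>, \<open>p\<close> belongs to the chain on \<open>\<Omega>\<close> and \<open>p'\<close> to the one on \<open>\<Omega>'\<close>. As transition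
  probabilities lie in \<open>[0, 1]\<close>, summability of \<open>R\<close> makes both infinite sums converge.
\<close>

definition reverse_duality_relation ::
    "'a set \<Rightarrow> 'b set \<Rightarrow> (real \<Rightarrow> 'a \<Rightarrow> 'a \<Rightarrow> real) \<Rightarrow> (real \<Rightarrow> 'b \<Rightarrow> 'b \<Rightarrow> real)
      \<Rightarrow> ('b \<Rightarrow> 'a \<Rightarrow> real) \<Rightarrow> real \<Rightarrow> 'a \<Rightarrow> 'b \<Rightarrow> bool" where
  "reverse_duality_relation \<Omega> \<Omega>' p p' R t x y \<longleftrightarrow>
     (\<Sum>\<^sub>\<infinity>x'\<in>\<Omega>. R y x' * p t x' x) = (\<Sum>\<^sub>\<infinity>y'\<in>\<Omega>'. R y' x * p' t y' y)"

definition reversely_dual ::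
    "'a set \<Rightarrow> 'b set \<Rightarrow> (real \<Rightarrow> 'a \<Rightarrow> 'a \<Rightarrow> real) \<Rightarrow> (real \<Rightarrow> 'b \<Rightarrow> 'b \<Rightarrow> real)
      \<Rightarrow> ('b \<Rightarrow> 'a \<Rightarrow> real) \<Rightarrow> bool" where
  "reversely_dual \<Omega> \<Omega>' p p' R \<longleftrightarrow>
     (\<forall>x\<in>\<Omega>. (\<lambda>y. R y x) summable_on \<Omega>') \<and>
     (\<forall>y\<in>\<Omega>'. (\<lambda>x. R y x) summable_on \<Omega>) \<and>
     (\<forall>t\<ge>0. \<forall>x\<in>\<Omega>. \<forall>y\<in>\<Omega>'. reverse_duality_relation \<Omega> \<Omega>' p p' R t x y)"

section \<open>The headway exclusion process\<close>

text \<open>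
  A configuration \<open>x\<^sub>1 < \<dots> < x\<^sub>N\<close> is a strictly increasing list; particle \<open>i\<close> of the
  mathematical notation is the list entry with index \<open>i - 1\<close>.
\<close>

definition configs :: "nat \<Rightarrow> int list set" where
  "configs N = {x. length x = N \<and> sorted_wrt (<) x}"

definition headway :: "int list \<Rightarrow> nat \<Rightarrow> enat" where
  "headway x i = (if Suc i < length x then enat (nat (x ! Suc i - x ! i - 1)) else \<infinity>)"

definition exp_neg :: "ereal \<Rightarrow> ennreal" where
  "exp_neg a = (if a = \<infinity> then 0 else if a = -\<infinity> then \<infinity> else ennreal (exp (- real_of_ereal a)))"

definition weight :: "(nat \<Rightarrow> ereal) \<Rightarrow> nat \<Rightarrow> ennreal" where
  "weight J k = (if k = 0 then 0 else exp_neg (J k))"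

text \<open>
  Computed in \<open>[0, \<infinity>]\<close>, where \<open>0 / 0 = 0\<close>, \<open>inverse 0 = \<infinity>\<close> and \<open>c / 0 = \<infinity>\<close> for \<open>c > 0\<close>. A process with these
  jump rates requires all of them to be finite; together with a finite partition function this
  forces \<open>J k < \<infinity>\<close> for all \<open>k \<ge> 1\<close>.
\<close>

definition rate_ratio :: "(nat \<Rightarrow> ereal) \<Rightarrow> nat \<Rightarrow> ennreal" where
  "rate_ratio J k = weight J k / weight J (Suc k)"

definition partition_function :: "(nat \<Rightarrow> ereal) \<Rightarrow> ennreal" where
  "partition_function J = (\<Sum>n. \<Prod>k=1..n. inverse (rate_ratio J k))"

lemma rate_ratio_0: "rate_ratio J 0 = 0"
  by (simp add: rate_ratio_def weight_def)

lemma rate_ratio_finite_potential: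
  assumes "1 \<le> k" "J k = ereal a" "J (Suc k) = ereal b"
  shows "rate_ratio J k = ennreal (exp (b - a))"
  using assms by (simp add: rate_ratio_def weight_def exp_neg_def divide_ennreal exp_diff exp_minus field_simps)

definition jump_rate :: "(nat \<Rightarrow> ereal) \<Rightarrow> real \<Rightarrow> int list \<Rightarrow> nat \<Rightarrow> real" where
  "jump_rate J w x i = (case headway x i of enat n \<Rightarrow> w * enn2real (rate_ratio J n) | \<infinity> \<Rightarrow> w)"

text \<open>
  The entries in row \<open>x\<close> sum to zero: a jump onto an occupied site would lead out of
  \<^term>\<open>configs N\<close>, but its rate is \<open>w * g\<^sub>0 = 0\<close>.
\<close>

definition tahep_intensity :: "(nat \<Rightarrow> ereal) \<Rightarrow> real \<Rightarrow> int list \<Rightarrow> int list \<Rightarrow> real" where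
  "tahep_intensity J w x y =
     (\<Sum>i<length x. jump_rate J w x i * (of_bool (y = x[i := x ! i + 1]) - of_bool (y = x)))"

definition walk_intensity :: "real \<Rightarrow> int \<Rightarrow> int \<Rightarrow> real" where
  "walk_intensity w x y = w * (of_bool (y = x - 1) - of_bool (y = x))"

text \<open>
  Given a finite partition function, \<open>duality_fun J N y\<close> is the probability mass function of a
  configuration with leftmost particle at \<open>y\<close> and i.i.d. headways. Let the walk have state
  space \<open>{..x\<^sup>*}\<close>. At a configuration with leftmost particle beyond \<open>x\<^sup>*\<close> the dual side of the
  duality relation is then zero whereas the other side can be positive, because the exclusion
  process enters such configurations. The relation can therefore hold at all configurations only
  for the walk on the whole of \<open>\<int>\<close>, and for the walk on \<open>{..x\<^sup>*}\<close> only at those with leftmost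
  particle in \<open>{..x\<^sup>*}\<close>.
\<close>

definition duality_fun :: "(nat \<Rightarrow> ereal) \<Rightarrow> nat \<Rightarrow> int \<Rightarrow> int list \<Rightarrow> real" where
  "duality_fun J N y x =
     of_bool (x ! 0 = y) / enn2real (partition_function J) ^ (N - 1) *
     (\<Prod>i<N - 1. \<Prod>k=1..nat (x ! Suc i - x ! i - 1). inverse (enn2real (rate_ratio J k)))"

end

theory Submission
  imports Defs
begin

text \<open>
  Started from i.i.d. stationary headways with leftmost particle at \<open>y\<close>, the exclusion process has
  at time \<open>s\<close> the candidate law \<open>h\<^sub>s(z) = Pois(z\<^sub>1 - y; w s) \<pi>(z)\<close>: headways stay stationary and
  the leftmost particle performs a Poisson walk. Under \<open>h\<^sub>s\<close> every particle has mean jump rate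
  \<open>w\<close>, so the expected exit rate is finite although the rates \<open>g\<^sub>k\<close> may be unbounded. Hence the
  forward equation for \<open>h\<close> and the transition probabilities \<open>p\<close> of any chain with this
  intensity matrix can be paired: \<open>\<Sum>\<^sub>z h\<^sub>s(z) p\<^sub>t\<^sub>-\<^sub>s(z, x)\<close> does not depend on \<open>s\<close>, and
  \<open>s = 0\<close>, \<open>s = t\<close> give \<open>h\<^sub>0 P\<^sub>t = h\<^sub>t\<close>. The same argument shows that the dual walk has Poisson
  transition probabilities, and both sides of the duality relation equal
  \<open>Pois(x\<^sub>1 - y; w t) \<pi>(x)\<close>.
\<close>

section \<open>Infinite sums\<close>

lemma has_sum_diff:
  fixes f g :: "'a \<Rightarrow> real"
  assumes "(f has_sum a) A" "(g has_sum b) A"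
  shows "((\<lambda>x. f x - g x) has_sum (a - b)) A"
  using has_sum_add[OF assms(1) has_sum_uminusI[OF assms(2)]] by simp

lemmas summable_on_diff = has_sum_imp_summable[OF has_sum_diff[OF has_sum_infsum has_sum_infsum]]
  and infsum_diff = infsumI[OF has_sum_diff[OF has_sum_infsum has_sum_infsum]]

lemma has_sum_sum:
  fixes f :: "'i \<Rightarrow> 'a \<Rightarrow> real"
  assumes "\<And>i. i \<in> I \<Longrightarrow> (f i has_sum s i) A"
  shows "((\<lambda>x. \<Sum>i\<in>I. f i x) has_sum (\<Sum>i\<in>I. s i)) A"
  using assms by (induction I rule: infinite_finite_induct) (auto intro: has_sum_add)

lemma summable_on_sum:
  fixes f :: "'i \<Rightarrow> 'a \<Rightarrow> real"
  assumes "\<And>i. i \<in> I \<Longrightarrow> f i summable_on A"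
  shows "(\<lambda>x. \<Sum>i\<in>I. f i x) summable_on A"
  by (rule has_sum_imp_summable[OF has_sum_sum[OF has_sum_infsum]]) (rule assms)

lemma infsum_sum:
  fixes f :: "'i \<Rightarrow> 'a \<Rightarrow> real"
  assumes "\<And>i. i \<in> I \<Longrightarrow> f i summable_on A"
  shows "(\<Sum>\<^sub>\<infinity>x\<in>A. \<Sum>i\<in>I. f i x) = (\<Sum>i\<in>I. \<Sum>\<^sub>\<infinity>x\<in>A. f i x)"
  by (rule infsumI[OF has_sum_sum[OF has_sum_infsum]]) (rule assms)

lemma summable_on_dominated:
  fixes f g :: "'a \<Rightarrow> real"
  assumes "g summable_on A" and "\<And>x. x \<in> A \<Longrightarrow> \<bar>f x\<bar> \<le> g x"
  shows "f summable_on A"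
proof -
  have "(\<lambda>x. norm (f x)) summable_on A"
    by (rule summable_on_comparison_test[OF assms(1)]) (use assms(2) in auto)
  then show ?thesis
    by (rule abs_summable_summable)
qed

lemma abs_infsum_le:
  fixes f g :: "'a \<Rightarrow> real"
  assumes "g summable_on A" and "\<And>x. x \<in> A \<Longrightarrow> \<bar>f x\<bar> \<le> g x"
  shows "\<bar>infsum f A\<bar> \<le> infsum g A"
proof -
  have "norm (infsum f A) \<le> infsum g A"
    by (rule norm_infsum_le[OF has_sum_infsum[OF summable_on_dominated[OF assms]] has_sum_infsum[OF assms(1)]])
      (simp_all add: assms(2))
  then show ?thesis by simp
qed

text \<open>Dominated convergence for unordered sums along an arbitrary filter: a finite set
  \<open>B\<close> carries all but \<epsilon>/2 of the dominating sum, and on \<open>B\<close> the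
  limit passes through a finite sum.\<close>

lemma tendsto_infsum_dominated_0:
  fixes f :: "'i \<Rightarrow> 'a \<Rightarrow> real"
  assumes g: "g summable_on A"
    and le: "\<forall>\<^sub>F i in F. \<forall>x\<in>A. \<bar>f i x\<bar> \<le> g x"
    and lim: "\<And>x. x \<in> A \<Longrightarrow> ((\<lambda>i. f i x) \<longlongrightarrow> 0) F"
  shows "((\<lambda>i. infsum (f i) A) \<longlongrightarrow> 0) F"
proof (rule tendstoI)
  fix \<epsilon> :: real assume \<epsilon>: "\<epsilon> > 0"
  obtain B where B: "finite B" "B \<subseteq> A" and dB: "dist (sum g B) (infsum g A) \<le> \<epsilon> / 2"
    using infsum_finite_approximation[OF g, of "\<epsilon> / 2"] \<epsilon> by auto
  have gB: "g summable_on B" and gAB: "g summable_on (A - B)"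
    using g B by (auto intro: summable_on_subset)
  have gd: "infsum g (A - B) \<le> \<epsilon> / 2"
    using infsum_Diff[OF g gB B(2)] dB B(1) abs_ge_minus_self[of "sum g B - infsum g A"]
    by (simp add: dist_real_def)
  have "((\<lambda>i. \<Sum>x\<in>B. \<bar>f i x\<bar>) \<longlongrightarrow> (\<Sum>x\<in>B. \<bar>0\<bar>)) F"
    using B lim by (intro tendsto_sum tendsto_rabs) auto
  then have "\<forall>\<^sub>F i in F. (\<Sum>x\<in>B. \<bar>f i x\<bar>) < \<epsilon> / 2"
    using \<epsilon> by (intro order_tendstoD) auto
  then show "\<forall>\<^sub>F i in F. dist (infsum (f i) A) 0 < \<epsilon>"
    using le
  proof eventually_elim
    case (elim i)
    have s: "f i summable_on A"
      by (rule summable_on_dominated[OF g]) (use elim in auto)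
    have "infsum (f i) (A - B) = infsum (f i) A - sum (f i) B"
      using infsum_Diff[OF s _ B(2)] B(1) by simp
    moreover have "\<bar>infsum (f i) (A - B)\<bar> \<le> infsum g (A - B)"
      by (rule abs_infsum_le[OF gAB]) (use elim in auto)
    moreover have "\<bar>sum (f i) B\<bar> \<le> (\<Sum>x\<in>B. \<bar>f i x\<bar>)"
      by (rule sum_abs)
    ultimately have "\<bar>infsum (f i) A\<bar> < \<epsilon>"
      using elim(1) gd by linarith
    then show ?case by simp
  qed
qed

text \<open>Turns limits for step size tending to \<open>0\<close> from the right into limits along
  equidistant partitions of \<open>[0, t]\<close>.\<close>

lemma filterlim_divide_at_right_0:
  fixes t :: real
  assumes "0 < t"
  shows "filterlim (\<lambda>n. t / real n) (at_right 0) sequentially"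
proof -
  have "\<forall>\<^sub>F n in sequentially. t / real n \<in> {0<..} \<and> t / real n \<noteq> 0"
    using eventually_gt_at_top[of 0] by eventually_elim (use assms in auto)
  then show ?thesis
    using lim_const_over_n[of t] by (simp add: filterlim_at)
qed

section \<open>Transition probabilities and the forward equation\<close>

context ctmc
begin

abbreviation p :: "real \<Rightarrow> 's \<Rightarrow> 's \<Rightarrow> real" where
  "p \<equiv> trans_prob P X"

lemma state_sets:
  assumes "x \<in> S" "0 \<le> t"
  shows "{\<omega> \<in> space (P x). X t \<omega> = y} \<in> sets (P x)"
proof (cases "y \<in> S")
  case True
  have "X t -` {y} \<inter> space (P x) \<in> sets (P x)"
    using True by (intro measurable_sets[OF random_variable[OF assms]]) auto
  then show ?thesis by (simp add: vimage_def Int_def conj_commute)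
next
  case False
  then have "{\<omega> \<in> space (P x). X t \<omega> = y} = {}"
    using measurable_space[OF random_variable[OF assms]] by auto
  then show ?thesis by (simp only: sets.empty_sets)
qed

text \<open>Countable additivity over the value of \<open>X t\<close>. Taking \<open>B\<close> as
  the whole space gives total mass one; taking a later event gives Chapman-Kolmogorov.\<close>

lemma has_sum_measure_states:
  assumes x: "x \<in> S" and t: "0 \<le> t" and B: "B \<in> sets (P x)"
  shows "((\<lambda>z. measure (P x) ({\<omega> \<in> space (P x). X t \<omega> = z} \<inter> B)) has_sum measure (P x) B) S"
proof -
  interpret prob_space "P x" by (rule prob_space[OF x])
  define A where "A z = {\<omega> \<in> space (P x). X t \<omega> = z} \<inter> B" for z
  have A: "A z \<in> sets (P x)" for z
    unfolding A_def using state_sets[OF x t] B by auto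
  have "(\<Union>z\<in>S. A z) = B"
    using sets.sets_into_space[OF B] measurable_space[OF random_variable[OF x t]]
    by (auto simp: A_def)
  moreover have "emeasure (P x) (\<Union>z\<in>S. A z) = (\<integral>\<^sup>+ z. emeasure (P x) (A z) \<partial>count_space S)"
    by (rule emeasure_UN_countable) (use A countable_states in \<open>auto simp: disjoint_family_on_def A_def\<close>)
  ultimately have "(\<integral>\<^sup>+ z. emeasure (P x) (A z) \<partial>count_space S) = emeasure (P x) B"
    by simp
  then have "(\<integral>\<^sup>+ z. ennreal (measure (P x) (A z)) \<partial>count_space S) = ennreal (measure (P x) B)"
    by (simp add: emeasure_eq_measure)
  \<comment> \<open>A finite integral of a nonnegative function over counting measure is a Bochner
    integral, which is the bridge to absolute summability and \<open>infsum\<close>.\<close>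
  then have *: "has_bochner_integral (count_space S) (\<lambda>z. measure (P x) (A z)) (measure (P x) B)"
    by (intro has_bochner_integral_nn_integral) auto
  then have abs: "Infinite_Set_Sum.abs_summable_on (\<lambda>z. measure (P x) (A z)) S"
    by (simp add: Infinite_Set_Sum.abs_summable_on_def has_bochner_integral_iff)
  have "infsum (\<lambda>z. measure (P x) (A z)) S = measure (P x) B"
    using infsetsum_infsum[OF abs] * by (simp add: infsetsum_def has_bochner_integral_iff)
  moreover have "(\<lambda>z. measure (P x) (A z)) summable_on S"
    using abs abs_summable_equivalent abs_summable_summable by blast
  ultimately show ?thesis
    by (simp add: A_def has_sum_iff)
qed

lemma p_nonneg: "0 \<le> p t x y"
  by (simp add: trans_prob_def)

lemma p_le_1: "x \<in> S \<Longrightarrow> p t x y \<le> 1"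
  unfolding trans_prob_def by (rule prob_space.prob_le_1) (rule prob_space)

lemma p_0:
  assumes "x \<in> S" "y \<in> S"
  shows "p 0 x y = of_bool (x = y)"
proof -
  interpret prob_space "P x" by (rule prob_space[OF assms(1)])
  have "AE \<omega> in P x. X 0 \<omega> = y \<longleftrightarrow> x = y"
    using initial[OF assms(1)] by auto
  then have "p 0 x y = measure (P x) {\<omega> \<in> space (P x). x = y}"
    unfolding trans_prob_def using state_sets[OF assms(1)]
    by (intro finite_measure_eq_AE) auto
  then show ?thesis using prob_space by auto
qed

lemma has_sum_p:
  assumes "x \<in> S" "0 \<le> t"
  shows "((\<lambda>y. p t x y) has_sum 1) S"
proof -
  interpret prob_space "P x" by (rule prob_space[OF assms(1)])
  have "{\<omega> \<in> space (P x). X t \<omega> = z} \<inter> space (P x) = {\<omega> \<in> space (P x). X t \<omega> = z}" for z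
    by auto
  then show ?thesis
    using has_sum_measure_states[OF assms sets.top] by (simp add: trans_prob_def prob_space)
qed

lemma chapman_kolmogorov:
  assumes "x \<in> S" "y \<in> S" "0 \<le> t" "0 \<le> s"
  shows "((\<lambda>z. p t x z * p s z y) has_sum p (t + s) x y) S"
proof -
  have "((\<lambda>z. measure (P x) ({\<omega> \<in> space (P x). X t \<omega> = z} \<inter> {\<omega> \<in> space (P x). X (t + s) \<omega> = y}))
    has_sum p (t + s) x y) S"
    unfolding trans_prob_def using assms by (intro has_sum_measure_states state_sets) auto
  moreover have "measure (P x) ({\<omega> \<in> space (P x). X t \<omega> = z} \<inter> {\<omega> \<in> space (P x). X (t + s) \<omega> = y})
      = p t x z * p s z y" if "z \<in> S" for z
  proof -
    have "{\<omega> \<in> space (P x). X t \<omega> = z} \<inter> {\<omega> \<in> space (P x). X (t + s) \<omega> = y} =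
       {\<omega> \<in> space (P x). X t \<omega> = z \<and> X (t + s) \<omega> = y}" by auto
    then show ?thesis
      \<comment> \<open>The Markov property with a single past time point,
        \<open>n = 0\<close>.\<close>
      using markov[of x y s "\<lambda>_. t" 0 "\<lambda>_. z"] assms that
      by (simp add: trans_prob_def mono_on_def)
  qed
  ultimately show ?thesis
    by (simp cong: has_sum_cong)
qed

lemma p_ge_mult:
  assumes "x \<in> S" "y \<in> S" "z \<in> S" "0 \<le> t" "0 \<le> s"
  shows "p t x z * p s z y \<le> p (t + s) x y"
  using finite_sum_le_has_sum[OF chapman_kolmogorov[OF assms(1,2,4,5)], of "{z}"] assms p_nonneg
  by simp

text \<open>Being in \<open>x\<close> at each of the times \<open>t\<close>, \<open>2 t\<close>,
  ..., \<open>n t\<close> is one way to be in \<open>x\<close> at time \<open>n t\<close>; iterate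
  \<open>p_ge_mult\<close>.\<close>

lemma p_diag_power:
  assumes "x \<in> S" "0 \<le> t"
  shows "p t x x ^ n \<le> p (real n * t) x x"
proof (induction n)
  case 0
  then show ?case using p_0 assms by simp
next
  case (Suc n)
  have "p t x x ^ Suc n \<le> p t x x * p (real n * t) x x"
    using Suc p_nonneg by (auto intro: mult_left_mono)
  also have "\<dots> \<le> p (t + real n * t) x x"
    using assms by (intro p_ge_mult) auto
  finally show ?case by (simp add: algebra_simps)
qed

text \<open>By \<open>p_diag_power\<close> and Bernoulli's inequality, \<open>p t x x\<close> is at
  least \<open>1 + n (p (t/n) x x - 1)\<close>, and this tends to \<open>1 + t Q x x\<close>. The
  intensity thus controls the loss at every positive time, not just asymptotically; this supplies
  the dominating function later on.\<close>

lemma one_minus_p_diag_le: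
  assumes x: "x \<in> S" and t: "0 < t"
  shows "1 - p t x x \<le> - Q x x * t"
proof -
  note lim0 = filterlim_divide_at_right_0[OF t]
  have "(\<lambda>n. (p (t / real n) x x - 1) / (t / real n)) \<longlonglongrightarrow> Q x x"
    using filterlim_compose[OF intensity[OF x x] lim0] by simp
  then have lim: "(\<lambda>n. 1 + t * ((p (t / real n) x x - 1) / (t / real n))) \<longlonglongrightarrow> 1 + t * Q x x"
    by (intro tendsto_intros)
  have "\<forall>\<^sub>F n in sequentially. 1 + t * ((p (t / real n) x x - 1) / (t / real n)) \<le> p t x x"
    using eventually_gt_at_top[of 0]
  proof eventually_elim
    case (elim n)
    have "1 + t * ((p (t / real n) x x - 1) / (t / real n)) = 1 + real n * (p (t / real n) x x - 1)"
      using t elim by simp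
    also have "\<dots> \<le> (1 + (p (t / real n) x x - 1)) ^ n"
      by (rule Bernoulli_inequality) (use p_nonneg[of "t / real n" x x] in simp)
    also have "\<dots> \<le> p (real n * (t / real n)) x x"
      using p_diag_power[OF x, of "t / real n" n] t by simp
    finally show ?case using elim by simp
  qed
  then have "1 + t * Q x x \<le> p t x x"
    by (rule tendsto_upperbound[OF lim]) simp
  then show ?thesis by (simp add: algebra_simps)
qed

lemma intensity_off_diagonal_nonneg:
  assumes x: "x \<in> S" "y \<in> S" "x \<noteq> y"
  shows "0 \<le> Q x y"
proof (rule tendsto_lowerbound[OF intensity[OF x(1,2)]])
  show "\<forall>\<^sub>F h in at_right 0. 0 \<le> (p h x y - of_bool (x = y)) / h"
    using eventually_at_right_less[of 0] by eventually_elim (simp add: p_nonneg x)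
qed simp

end

section \<open>First-step analysis for conservative rows with finitely many targets\<close>

locale row_finite_ctmc = ctmc S Q P X
  for S :: "'s set" and Q :: "'s \<Rightarrow> 's \<Rightarrow> real"
    and P :: "'s \<Rightarrow> 'w measure" and X :: "real \<Rightarrow> 'w \<Rightarrow> 's" +
  fixes succs :: "'s \<Rightarrow> 's set"
  assumes finite_succs: "x \<in> S \<Longrightarrow> finite (succs x)"
    and succs_subset: "x \<in> S \<Longrightarrow> succs x \<subseteq> S"
    and self_in_succs: "x \<in> S \<Longrightarrow> x \<in> succs x"
    and conservative: "x \<in> S \<Longrightarrow> (\<Sum>y\<in>succs x. Q x y) = 0"
begin

text \<open>An l1 distance between the difference quotient of row \<open>x\<close> and
  \<open>Q\<close>: the entries in \<open>succs x\<close> are compared one by one, and the last term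
  is the probability of being outside \<open>succs x\<close> at time \<open>d\<close>, divided by
  \<open>d\<close>.\<close>

definition row_error :: "real \<Rightarrow> 's \<Rightarrow> real" where
  "row_error d x = (\<Sum>y\<in>succs x. \<bar>(p d x y - of_bool (x = y)) / d - Q x y\<bar>)
     + (1 - (\<Sum>y\<in>succs x. p d x y)) / d"

lemma sum_p_succs_le_1:
  assumes "x \<in> S" "0 \<le> d"
  shows "(\<Sum>y\<in>succs x. p d x y) \<le> 1"
  by (rule finite_sum_le_has_sum[OF has_sum_p[OF assms] finite_succs succs_subset])
    (simp_all add: assms p_nonneg)

lemma row_error_nonneg: "x \<in> S \<Longrightarrow> 0 < d \<Longrightarrow> 0 \<le> row_error d x"
  unfolding row_error_def using sum_p_succs_le_1[of x d] by (auto intro!: add_nonneg_nonneg sum_nonneg)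

text \<open>Since \<open>x\<close> itself lies in \<open>succs x\<close>, the mass outside divided
  by \<open>d\<close> is minus the sum of the difference quotients inside. Its limit is minus the
  row sum of \<open>Q\<close>, hence \<open>0\<close>.\<close>

lemma row_error_tendsto_0:
  assumes x: "x \<in> S"
  shows "((\<lambda>d. row_error d x) \<longlongrightarrow> 0) (at_right 0)"
proof -
  have lim: "((\<lambda>d. (p d x y - of_bool (x = y)) / d) \<longlongrightarrow> Q x y) (at_right 0)" if "y \<in> succs x" for y
    using intensity x succs_subset that by blast
  have one: "(\<Sum>y\<in>succs x. of_bool (x = y)) = (1::real)"
    using finite_succs[OF x] self_in_succs[OF x] by (simp add: of_bool_def)
  have eq: "(1 - (\<Sum>y\<in>succs x. p d x y)) / d = - (\<Sum>y\<in>succs x. (p d x y - of_bool (x = y)) / d)" for d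
    by (simp only: sum_divide_distrib[symmetric] sum_subtractf one) (simp add: diff_divide_distrib)
  have "((\<lambda>d. row_error d x) \<longlongrightarrow>
      (\<Sum>y\<in>succs x. \<bar>Q x y - Q x y\<bar>) + - (\<Sum>y\<in>succs x. Q x y)) (at_right 0)"
    unfolding row_error_def eq
    by (rule tendsto_add[OF tendsto_sum tendsto_minus[OF tendsto_sum]])
      (intro tendsto_rabs tendsto_diff tendsto_const lim, assumption)+
  then show ?thesis using conservative[OF x] by simp
qed

text \<open>The factor 4 counts multiples of the exit rate \<open>- Q x x\<close>: one for the
  diagonal entry, two for the off-diagonal entries (one for the quotients, one for
  \<open>Q\<close>), one for the mass outside \<open>succs x\<close>. The bound is uniform in
  \<open>d\<close>, as dominated convergence requires.\<close>

lemma row_error_le: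
  assumes x: "x \<in> S" and d: "0 < d"
  shows "row_error d x \<le> 4 * (- Q x x)"
proof -
  note fin = finite_succs[OF x] and self = self_in_succs[OF x]
  let ?A = "succs x - {x}"
  have pd: "1 - p d x x \<le> - Q x x * d" by (rule one_minus_p_diag_le[OF x d])
  have split: "(\<Sum>y\<in>succs x. f y) = f x + (\<Sum>y\<in>?A. f y)" for f :: "'s \<Rightarrow> real"
    using fin self by (rule sum.remove)
  have sumQ: "(\<Sum>y\<in>?A. Q x y) = - Q x x"
    using conservative[OF x] split[of "Q x"] by simp
  have sump: "p d x x + (\<Sum>y\<in>?A. p d x y) \<le> 1"
    using sum_p_succs_le_1[OF x, of d] d split[of "p d x"] by simp
  have "\<bar>(p d x x - 1) / d - Q x x\<bar> \<le> - Q x x"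
  proof -
    have "- (- Q x x) \<le> (p d x x - 1) / d"
      using pd d by (simp add: field_simps)
    moreover have "(p d x x - 1) / d \<le> 0"
      using p_le_1[OF x, of d x] d by (simp add: divide_le_0_iff)
    ultimately show ?thesis by linarith
  qed
  moreover have "(\<Sum>y\<in>?A. \<bar>(p d x y - of_bool (x = y)) / d - Q x y\<bar>) \<le> - Q x x + - Q x x"
  proof -
    have "(\<Sum>y\<in>?A. \<bar>(p d x y - of_bool (x = y)) / d - Q x y\<bar>) \<le> (\<Sum>y\<in>?A. p d x y / d + Q x y)"
    proof (rule sum_mono)
      fix y assume y: "y \<in> ?A"
      then have "0 \<le> Q x y"
        using intensity_off_diagonal_nonneg[OF x, of y] succs_subset[OF x] by blast
      moreover have "0 \<le> p d x y / d" using p_nonneg d by simp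
      ultimately show "\<bar>(p d x y - of_bool (x = y)) / d - Q x y\<bar> \<le> p d x y / d + Q x y"
        using y by auto
    qed
    also have "\<dots> = (\<Sum>y\<in>?A. p d x y) / d + - Q x x"
      by (simp add: sum.distrib sum_divide_distrib sumQ)
    also have "(\<Sum>y\<in>?A. p d x y) / d \<le> - Q x x"
      using sump pd d by (simp add: field_simps)
    finally show ?thesis by simp
  qed
  moreover have "(1 - (\<Sum>y\<in>succs x. p d x y)) / d \<le> - Q x x"
  proof -
    have "0 \<le> (\<Sum>y\<in>?A. p d x y)" using p_nonneg by (intro sum_nonneg) auto
    then have "1 - (\<Sum>y\<in>succs x. p d x y) \<le> - Q x x * d"
      using pd split[of "p d x"] by simp
    then show ?thesis using d by (simp add: field_simps)
  qed
  moreover have "row_error d x = \<bar>(p d x x - 1) / d - Q x x\<bar>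
      + (\<Sum>y\<in>?A. \<bar>(p d x y - of_bool (x = y)) / d - Q x y\<bar>) + (1 - (\<Sum>y\<in>succs x. p d x y)) / d"
    unfolding row_error_def by (subst split) simp
  ultimately show ?thesis by linarith
qed

text \<open>Split the path at time \<open>d\<close> and replace row \<open>x\<close> of
  \<open>p d\<close> by that of \<open>I + d Q\<close>. As the remaining probabilities lie in
  \<open>[0, 1]\<close>, the mistake is at most the l1 error of the row.\<close>

lemma backward_increment:
  assumes x: "x \<in> S" and y: "y \<in> S" and r: "0 \<le> r" and d: "0 < d"
  shows "\<bar>p (d + r) x y - p r x y - d * (\<Sum>z\<in>succs x. Q x z * p r z y)\<bar> \<le> d * row_error d x"
proof -
  note fin = finite_succs[OF x] and self = self_in_succs[OF x] and sub = succs_subset[OF x]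
  define u where "u z = p r z y" for z
  have u0: "0 \<le> u z" for z by (simp add: u_def p_nonneg)
  have u1: "u z \<le> 1" if "z \<in> S" for z using that by (simp add: u_def p_le_1)
  have ck: "((\<lambda>z. p d x z * u z) has_sum p (d + r) x y) S"
    unfolding u_def using chapman_kolmogorov[OF x y] d r by simp
  have hs: "((\<lambda>z. p d x z * u z) has_sum (p (d + r) x y - (\<Sum>z\<in>succs x. p d x z * u z))) (S - succs x)"
    by (rule has_sum_Diff[OF ck has_sum_finite[OF fin] sub])
  have hp: "((\<lambda>z. p d x z) has_sum (1 - (\<Sum>z\<in>succs x. p d x z))) (S - succs x)"
    using d by (intro has_sum_Diff[OF has_sum_p[OF x] has_sum_finite[OF fin] sub]) auto
  \<comment> \<open>The part of the Chapman-Kolmogorov sum outside \<open>succs x\<close> lies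
    between \<open>0\<close> and the mass that \<open>p d x\<close> puts there.\<close>
  have lo: "0 \<le> p (d + r) x y - (\<Sum>z\<in>succs x. p d x z * u z)"
    by (rule has_sum_nonneg[OF hs]) (simp add: u0 p_nonneg)
  have hi: "p (d + r) x y - (\<Sum>z\<in>succs x. p d x z * u z) \<le> 1 - (\<Sum>z\<in>succs x. p d x z)"
    by (rule has_sum_mono[OF hs hp]) (use u1 p_nonneg in \<open>auto intro: mult_left_le\<close>)
  have ux: "u x = (\<Sum>z\<in>succs x. of_bool (x = z) * u z)"
    using fin self by (simp add: of_bool_def if_distrib[of "\<lambda>c. c * _"] cong: if_cong)
  have "(\<Sum>z\<in>succs x. p d x z * u z) - u x - d * (\<Sum>z\<in>succs x. Q x z * u z)
      = d * (\<Sum>z\<in>succs x. ((p d x z - of_bool (x = z)) / d - Q x z) * u z)"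
    unfolding sum_distrib_left ux sum_subtractf[symmetric]
    using d by (intro sum.cong refl) (simp add: field_simps)
  moreover have "\<bar>\<Sum>z\<in>succs x. ((p d x z - of_bool (x = z)) / d - Q x z) * u z\<bar>
      \<le> (\<Sum>z\<in>succs x. \<bar>(p d x z - of_bool (x = z)) / d - Q x z\<bar>)"
  proof (rule order_trans[OF sum_abs sum_mono])
    fix z assume "z \<in> succs x"
    then have "u z \<le> 1" using u1 sub by auto
    then show "\<bar>((p d x z - of_bool (x = z)) / d - Q x z) * u z\<bar> \<le> \<bar>(p d x z - of_bool (x = z)) / d - Q x z\<bar>"
      using u0[of z] by (simp add: abs_mult mult_left_le)
  qed
  then have "\<bar>d * (\<Sum>z\<in>succs x. ((p d x z - of_bool (x = z)) / d - Q x z) * u z)\<bar>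
      \<le> d * (\<Sum>z\<in>succs x. \<bar>(p d x z - of_bool (x = z)) / d - Q x z\<bar>)"
    using d by (simp add: abs_mult)
  moreover have "d * row_error d x = d * (\<Sum>z\<in>succs x. \<bar>(p d x z - of_bool (x = z)) / d - Q x z\<bar>)
      + (1 - (\<Sum>z\<in>succs x. p d x z))"
    using d by (simp add: row_error_def distrib_left)
  ultimately have "\<bar>p (d + r) x y - u x - d * (\<Sum>z\<in>succs x. Q x z * u z)\<bar> \<le> d * row_error d x"
    using lo hi by linarith
  then show ?thesis by (simp add: u_def)
qed

text \<open>
  The weak forward equation makes \<open>F s = (\<Sum>z\<in>S. h s z * p (t - s) z y)\<close> constant on \<open>[0, t]\<close>:
  its increments over steps of length \<open>t / n\<close> are \<open>o(1 / n)\<close>, uniformly in \<open>s\<close>. Finiteness of the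
  expected exit rate replaces a non-explosion argument.
\<close>

theorem forward_equation_unique:
  fixes h g :: "real \<Rightarrow> 's \<Rightarrow> real" and H G K :: "'s \<Rightarrow> real"
  assumes t: "0 \<le> t" and y: "y \<in> S"
    and h0: "\<And>s z. \<lbrakk>0 \<le> s; s \<le> t; z \<in> S\<rbrakk> \<Longrightarrow> 0 \<le> h s z"
    and hH: "\<And>s z. \<lbrakk>0 \<le> s; s \<le> t; z \<in> S\<rbrakk> \<Longrightarrow> h s z \<le> H z"
    and gK: "\<And>s z. \<lbrakk>0 \<le> s; s \<le> t; z \<in> S\<rbrakk> \<Longrightarrow> \<bar>g s z\<bar> \<le> K z"
    and H: "H summable_on S" and HQ: "(\<lambda>z. H z * - Q z z) summable_on S"
    and G: "G summable_on S" and K: "K summable_on S"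
    and taylor: "\<And>s d z. \<lbrakk>0 \<le> s; 0 \<le> d; s + d \<le> t; z \<in> S\<rbrakk> \<Longrightarrow>
        \<bar>h (s + d) z - h s z - d * g s z\<bar> \<le> d\<^sup>2 * G z"
    and weak: "\<And>s u. \<lbrakk>0 \<le> s; s \<le> t; \<And>z. z \<in> S \<Longrightarrow> 0 \<le> u z \<and> u z \<le> 1\<rbrakk> \<Longrightarrow>
        (\<Sum>\<^sub>\<infinity>z\<in>S. h s z * (\<Sum>y\<in>succs z. Q z y * u y)) = (\<Sum>\<^sub>\<infinity>z\<in>S. g s z * u z)"
  shows "(\<Sum>\<^sub>\<infinity>z\<in>S. h 0 z * p t z y) = h t y"
proof -
  \<comment> \<open>\<open>F\<close> runs the candidate \<open>h\<close> up to time \<open>s\<close>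
    and the chain from then on; \<open>E\<close> is the mean row error under the time-independent
    majorant \<open>H\<close>.\<close>
  define F where "F s = (\<Sum>\<^sub>\<infinity>z\<in>S. h s z * p (t - s) z y)" for s
  define E where "E d = (\<Sum>\<^sub>\<infinity>z\<in>S. H z * row_error d z)" for d
  have H0: "0 \<le> H z" if "z \<in> S" for z using h0[of 0 z] hH[of 0 z] that t by simp
  have dom: "\<bar>H z * row_error d z\<bar> \<le> 4 * (H z * - Q z z)" if "z \<in> S" "0 < d" for z d
    using mult_left_mono[OF row_error_le[OF that] H0[OF that(1)]] H0[OF that(1)]
      row_error_nonneg[OF that] by simp
  have HQ4: "(\<lambda>z. 4 * (H z * - Q z z)) summable_on S" by (rule summable_on_cmult_right[OF HQ])
  have sE: "(\<lambda>z. H z * row_error d z) summable_on S" if "0 < d" for d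
    by (rule summable_on_dominated[OF HQ4]) (use dom that in blast)
  have E: "(E \<longlongrightarrow> 0) (at_right 0)"
    unfolding E_def
  proof (rule tendsto_infsum_dominated_0[OF HQ4])
    show "\<forall>\<^sub>F d in at_right 0. \<forall>z\<in>S. \<bar>H z * row_error d z\<bar> \<le> 4 * (H z * - Q z z)"
      using eventually_at_right_less[of 0] by eventually_elim (use dom in blast)
    show "((\<lambda>d. H z * row_error d z) \<longlongrightarrow> 0) (at_right 0)" if "z \<in> S" for z
      using tendsto_mult_left[OF row_error_tendsto_0[OF that], of "H z"] by simp
  qed
  have step: "\<bar>F (s + d) - F s\<bar> \<le> d\<^sup>2 * infsum G S + d * E d"
    if s: "0 \<le> s" and d: "0 < d" and sd: "s + d \<le> t" for s d
  proof -
    define u where "u z = p (t - (s + d)) z y" for z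
    have u: "0 \<le> u z \<and> u z \<le> 1" if "z \<in> S" for z
      using that by (simp add: u_def p_nonneg p_le_1)
    define v where "v z = p (t - s) z y" for z
    have v: "0 \<le> v z \<and> v z \<le> 1" if "z \<in> S" for z
      using that by (simp add: v_def p_nonneg p_le_1)
    define q where "q z = (\<Sum>x\<in>succs z. Q z x * u x)" for z
    have inc: "\<bar>v z - u z - d * q z\<bar> \<le> d * row_error d z" if "z \<in> S" for z
      using backward_increment[OF that y, of "t - (s + d)" d] d sd
      by (simp add: u_def v_def q_def)
    have "\<bar>h s z * u' z\<bar> \<le> H z" if "z \<in> S" "0 \<le> s" "s \<le> t" "0 \<le> u' z \<and> u' z \<le> 1" for u' z s
      using that h0[of s z] hH[of s z] mult_mono[of "h s z" "H z" "u' z" 1] by (simp add: abs_mult)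
    then have sum1: "(\<lambda>z. h s z * u' z) summable_on S"
      if "0 \<le> s" "s \<le> t" "\<And>z. z \<in> S \<Longrightarrow> 0 \<le> u' z \<and> u' z \<le> 1" for u' s
      using that by (intro summable_on_dominated[OF H]) auto
    have s_hu: "(\<lambda>z. h (s + d) z * u z) summable_on S" and s_hu': "(\<lambda>z. h s z * u z) summable_on S"
      and s_hv: "(\<lambda>z. h s z * v z) summable_on S"
      using s d sd u v by (auto intro!: sum1)
    have "\<bar>g s z * u z\<bar> \<le> K z" if "z \<in> S" for z
      using that gK[of s z] s d sd u[OF that] mult_mono[of "\<bar>g s z\<bar>" "K z" "u z" 1]
      by (simp add: abs_mult)
    then have s_gu: "(\<lambda>z. g s z * u z) summable_on S"
      by (intro summable_on_dominated[OF K])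
    have bd_R: "\<bar>h s z * (v z - u z - d * q z)\<bar> \<le> d * (H z * row_error d z)" if "z \<in> S" for z
      using mult_mono[OF hH inc, of s z z] that s d sd h0[of s z] H0[of z]
      by (simp add: abs_mult mult_ac)
    have s_E': "(\<lambda>z. d * (H z * row_error d z)) summable_on S"
      by (rule summable_on_cmult_right[OF sE[OF d]])
    have s_R: "(\<lambda>z. h s z * (v z - u z - d * q z)) summable_on S"
      using bd_R by (rule summable_on_dominated[OF s_E'])
    \<comment> \<open>Summability of \<open>h s z * q z\<close> is recovered by solving
      \<open>inc\<close> for \<open>q\<close>: it is \<open>1 / d\<close> times a difference of
      three summable terms.\<close>
    have "(\<lambda>z. (1 / d) * ((h s z * v z - h s z * u z) - h s z * (v z - u z - d * q z))) summable_on S"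
      by (intro summable_on_cmult_right summable_on_diff s_hv s_hu' s_R)
    then have s_hq: "(\<lambda>z. h s z * q z) summable_on S"
      using d by (simp add: algebra_simps)
    have bd_T: "\<bar>(h (s + d) z - h s z - d * g s z) * u z\<bar> \<le> d\<^sup>2 * G z" if "z \<in> S" for z
      using mult_mono[OF taylor, of s d z "u z" 1] u[of z] s d sd that taylor[of s d z]
      by (simp add: abs_mult)
    have s_G': "(\<lambda>z. d\<^sup>2 * G z) summable_on S" by (rule summable_on_cmult_right[OF G])
    have s_T: "(\<lambda>z. (h (s + d) z - h s z - d * g s z) * u z) summable_on S"
      using bd_T by (rule summable_on_dominated[OF s_G'])
    have w: "infsum (\<lambda>z. h s z * q z) S = infsum (\<lambda>z. g s z * u z) S"
      unfolding q_def using s d sd u by (intro weak) auto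
    have "F (s + d) - F s = (\<Sum>\<^sub>\<infinity>z\<in>S. h (s + d) z * u z - h s z * v z)"
      unfolding F_def u_def[symmetric] v_def[symmetric] by (rule infsum_diff[symmetric]; fact)
    also have "\<dots> = (\<Sum>\<^sub>\<infinity>z\<in>S. ((h (s + d) z - h s z - d * g s z) * u z - h s z * (v z - u z - d * q z))
        + d * (g s z * u z - h s z * q z))"
      by (rule infsum_cong) (simp add: algebra_simps)
    \<comment> \<open>Insert the first-order terms of both factors: what remains is a Taylor error
      in \<open>h\<close>, a row error in \<open>p\<close>, and \<open>d\<close> times a difference
      that the weak forward equation annihilates.\<close>
    also have "\<dots> = (\<Sum>\<^sub>\<infinity>z\<in>S. (h (s + d) z - h s z - d * g s z) * u z)
        - (\<Sum>\<^sub>\<infinity>z\<in>S. h s z * (v z - u z - d * q z))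
        + d * ((\<Sum>\<^sub>\<infinity>z\<in>S. g s z * u z) - (\<Sum>\<^sub>\<infinity>z\<in>S. h s z * q z))"
      using s_T s_R s_gu s_hq
      by (simp add: infsum_add infsum_diff infsum_cmult_right summable_on_diff summable_on_cmult_right)
    finally have "F (s + d) - F s = (\<Sum>\<^sub>\<infinity>z\<in>S. (h (s + d) z - h s z - d * g s z) * u z)
        - (\<Sum>\<^sub>\<infinity>z\<in>S. h s z * (v z - u z - d * q z))"
      using w by simp
    moreover have "\<bar>\<Sum>\<^sub>\<infinity>z\<in>S. (h (s + d) z - h s z - d * g s z) * u z\<bar> \<le> d\<^sup>2 * infsum G S"
      using abs_infsum_le[OF s_G' bd_T] by (simp add: infsum_cmult_right')
    moreover have "\<bar>\<Sum>\<^sub>\<infinity>z\<in>S. h s z * (v z - u z - d * q z)\<bar> \<le> d * E d"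
      using abs_infsum_le[OF s_E' bd_R] by (simp add: infsum_cmult_right' E_def)
    ultimately show ?thesis by linarith
  qed
  have "F 0 = F t"
  proof (cases "t = 0")
    case False
    then have tpos: "0 < t" using t by simp
    note lim0 = filterlim_divide_at_right_0[OF tpos]
    \<comment> \<open>With \<open>d = t / n\<close>, the \<open>n\<close> step bounds add up to
      \<open>t (d * infsum G S + E d)\<close>.\<close>
    have "(\<lambda>n. t * ((t / real n) * infsum G S + E (t / real n))) \<longlonglongrightarrow> t * (0 * infsum G S + 0)"
      by (intro tendsto_intros filterlim_compose[OF E lim0] lim_const_over_n)
    moreover have "\<forall>\<^sub>F n in sequentially. \<bar>F t - F 0\<bar> \<le> t * ((t / real n) * infsum G S + E (t / real n))"
      using eventually_gt_at_top[of 0]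
    proof eventually_elim
      case (elim n)
      define d where "d = t / real n"
      have d: "0 < d" "real n * d = t" using elim tpos by (auto simp: d_def)
      have "\<bar>F (real n * d) - F (real 0 * d)\<bar> = \<bar>\<Sum>j<n. F (real (Suc j) * d) - F (real j * d)\<bar>"
        by (subst sum_lessThan_telescope) simp
      also have "\<dots> \<le> (\<Sum>j<n. d\<^sup>2 * infsum G S + d * E d)"
      proof (rule order_trans[OF sum_abs sum_mono])
        fix j assume "j \<in> {..<n}"
        then have "real (Suc j) * d \<le> real n * d" using d by (intro mult_right_mono) auto
        then have "real j * d + d \<le> t" using d by (simp add: algebra_simps)
        then show "\<bar>F (real (Suc j) * d) - F (real j * d)\<bar> \<le> d\<^sup>2 * infsum G S + d * E d"
          using step[of "real j * d" d] d by (simp add: algebra_simps)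
      qed
      also have "\<dots> = (real n * d) * (d * infsum G S + E d)"
        by (simp add: power2_eq_square algebra_simps)
      finally show ?case using d by (simp add: d_def[symmetric])
    qed
    ultimately have "\<bar>F t - F 0\<bar> \<le> t * (0 * infsum G S + 0)"
      by (intro tendsto_lowerbound) auto
    then show ?thesis by simp
  qed simp
  moreover have "F t = h t y"
  proof -
    have "F t = (\<Sum>\<^sub>\<infinity>z\<in>S. if z = y then h t y else 0)"
      unfolding F_def by (rule infsum_cong) (auto simp: p_0 y)
    also have "\<dots> = (\<Sum>\<^sub>\<infinity>z\<in>{y}. h t y)"
      by (rule infsum_cong_neutral) (use y in auto)
    finally show ?thesis by simp
  qed
  ultimately show ?thesis by (simp add: F_def)
qed

end

section \<open>Poisson weights and the dual walk\<close>

text \<open>Extended by \<open>0\<close> to negative \<open>k\<close>, so that the differential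
  recursion in \<open>k\<close> has no boundary case.\<close>

definition poisson_weight :: "int \<Rightarrow> real \<Rightarrow> real" where
  "poisson_weight k r = (if k < 0 then 0 else exp (- r) * r ^ nat k / fact (nat k))"

text \<open>Dropping the factor \<open>exp (- r)\<close> leaves a bound uniform in \<open>r\<close>
  on \<open>[0, M]\<close> that is still summable over \<open>k\<close>, by the exponential
  series.\<close>

definition poisson_bound :: "real \<Rightarrow> int \<Rightarrow> real" where
  "poisson_bound M k = (if k < 0 then 0 else M ^ nat k / fact (nat k))"

lemma poisson_weight_0: "poisson_weight k 0 = of_bool (k = 0)"
  by (auto simp: poisson_weight_def)

lemma poisson_weight_nonneg: "0 \<le> r \<Longrightarrow> 0 \<le> poisson_weight k r"
  by (simp add: poisson_weight_def)

lemma poisson_weight_le_bound: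
  assumes "0 \<le> r" "r \<le> M"
  shows "poisson_weight k r \<le> poisson_bound M k"
proof -
  have "exp (- r) * r ^ nat k \<le> 1 * M ^ nat k"
    using assms by (intro mult_mono power_mono) auto
  then show ?thesis
    by (simp add: poisson_weight_def poisson_bound_def divide_right_mono)
qed

lemma poisson_weight_deriv:
  "(poisson_weight k has_real_derivative (poisson_weight (k - 1) r - poisson_weight k r)) (at r)"
proof (cases "k \<le> 0")
  case True
  have "poisson_weight k = (\<lambda>r. if k < 0 then 0 else exp (- r))"
    using True by (auto simp: poisson_weight_def fun_eq_iff)
  then show ?thesis
    using True by (auto simp: poisson_weight_def intro!: derivative_eq_intros)
next
  case False
  define n where "n = nat (k - 1)"
  have k: "k = int (Suc n)" using False by (simp add: n_def)
  have eq: "poisson_weight k = (\<lambda>r. exp (- r) * r ^ Suc n / fact (Suc n))"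
    using k by (auto simp: poisson_weight_def fun_eq_iff nat_add_distrib)
  have "((\<lambda>r::real. exp (- r) * r ^ Suc n / fact (Suc n)) has_real_derivative
      (exp (- r) * r ^ n / fact n - exp (- r) * r ^ Suc n / fact (Suc n))) (at r)"
    by (auto intro!: derivative_eq_intros simp: divide_simps simp del: power_Suc)
  moreover have "poisson_weight (k - 1) r = exp (- r) * r ^ n / fact n"
    using k by (simp add: poisson_weight_def)
  ultimately show ?thesis unfolding eq by simp
qed

text \<open>Two uses of the mean value theorem; compared with the sharp remainder they lose a factor
  1/2, harmless where only order \<open>d\<^sup>2\<close> counts.\<close>

lemma taylor_order_two_bound:
  fixes f :: "real \<Rightarrow> real"
  assumes ab: "a \<le> b"
    and f': "\<And>x. (f has_real_derivative f' x) (at x)"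
    and f'': "\<And>x. (f' has_real_derivative f'' x) (at x)"
    and C: "\<And>x. \<lbrakk>a \<le> x; x \<le> b\<rbrakk> \<Longrightarrow> \<bar>f'' x\<bar> \<le> C"
  shows "\<bar>f b - f a - (b - a) * f' a\<bar> \<le> (b - a)\<^sup>2 * C"
proof (cases "a = b")
  case False
  then have "a < b" using ab by simp
  then obtain x where x: "a < x" "x < b" "f b - f a = (b - a) * f' x"
    using MVT2[of a b f f'] f' by auto
  then obtain y where y: "a < y" "y < x" "f' x - f' a = (x - a) * f'' y"
    using MVT2[of a x f' f''] f'' by auto
  have "f b - f a - (b - a) * f' a = (b - a) * (f' x - f' a)"
    by (simp add: x(3) algebra_simps)
  also have "\<bar>\<dots>\<bar> = (b - a) * (x - a) * \<bar>f'' y\<bar>"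
    using x y by (simp add: abs_mult)
  also have "\<dots> \<le> (b - a) * (b - a) * C"
    using x y C[of y] ab by (intro mult_mono) auto
  finally show ?thesis by (simp add: power2_eq_square)
qed simp

text \<open>The second derivative of the weights is the second difference in \<open>k\<close>, hence
  the coefficients 1, 2, 1. Each time derivative contributes a factor \<open>w\<close>.\<close>

lemma poisson_weight_taylor:
  assumes w: "0 \<le> w" and s: "0 \<le> s" "0 \<le> d" "s + d \<le> t"
  shows "\<bar>poisson_weight k (w * (s + d)) - poisson_weight k (w * s)
      - d * (w * (poisson_weight (k - 1) (w * s) - poisson_weight k (w * s)))\<bar>
    \<le> d\<^sup>2 * (w\<^sup>2 * (poisson_bound (w * t) (k - 2) + 2 * poisson_bound (w * t) (k - 1)
        + poisson_bound (w * t) k))" (is "?l \<le> d\<^sup>2 * (w\<^sup>2 * ?C)")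
proof -
  let ?f' = "\<lambda>r. poisson_weight (k - 1) r - poisson_weight k r"
  let ?f'' = "\<lambda>r. (poisson_weight (k - 2) r - poisson_weight (k - 1) r)
    - (poisson_weight (k - 1) r - poisson_weight k r)"
  have f'': "(?f' has_real_derivative ?f'' r) (at r)" for r
    using DERIV_diff[OF poisson_weight_deriv[of "k - 1" r] poisson_weight_deriv[of k r]] by simp
  have C: "\<bar>?f'' r\<bar> \<le> ?C" if "w * s \<le> r" "r \<le> w * (s + d)" for r
  proof -
    have "0 \<le> w * s" using w s by simp
    then have r0: "0 \<le> r" using that by linarith
    have "w * (s + d) \<le> w * t" using w s by (intro mult_left_mono) auto
    then have r1: "r \<le> w * t" using that by linarith
    show ?thesis
      using poisson_weight_nonneg[OF r0, of k] poisson_weight_nonneg[OF r0, of "k - 1"]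
        poisson_weight_nonneg[OF r0, of "k - 2"] poisson_weight_le_bound[OF r0 r1, of k]
        poisson_weight_le_bound[OF r0 r1, of "k - 1"] poisson_weight_le_bound[OF r0 r1, of "k - 2"]
      by linarith
  qed
  have "\<bar>poisson_weight k (w * (s + d)) - poisson_weight k (w * s) - (w * (s + d) - w * s) * ?f' (w * s)\<bar>
      \<le> (w * (s + d) - w * s)\<^sup>2 * ?C"
    using w s by (intro taylor_order_two_bound[OF _ poisson_weight_deriv f'' C])
      (auto intro: mult_left_mono)
  then show ?thesis by (simp add: algebra_simps power_mult_distrib)
qed

lemma poisson_bound_summable:
  assumes "0 \<le> M"
  shows "poisson_bound M summable_on UNIV"
proof -
  have "(\<lambda>n. M ^ n / fact n) summable_on (UNIV :: nat set)"
    using summable_exp[of M] assms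
    by (intro summable_nonneg_imp_summable_on) (simp_all add: field_simps)
  then have "(poisson_bound M \<circ> int) summable_on UNIV"
    by (simp add: poisson_bound_def o_def)
  then have "poisson_bound M summable_on range int"
    by (subst summable_on_reindex) auto
  then show ?thesis
    by (rule summable_on_cong_neutral[THEN iffD1, rotated -1])
      (auto simp: poisson_bound_def image_iff, (metis nonneg_int_cases not_le)+)
qed

lemma summable_on_int_affine:
  fixes f :: "int \<Rightarrow> real"
  assumes "f summable_on UNIV"
  shows "(\<lambda>z. f (z - a)) summable_on S" "(\<lambda>z. f (a - z)) summable_on S"
proof -
  have "bij (\<lambda>z::int. z - a)" "bij (\<lambda>z::int. a - z)"
    by (rule bij_betw_byWitness[where f' = "\<lambda>z. z + a"] bij_betw_byWitness[where f' = "\<lambda>z. a - z"]; simp)+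
  then have "(\<lambda>z. f (z - a)) summable_on UNIV" "(\<lambda>z. f (a - z)) summable_on UNIV"
    using assms summable_on_reindex_bij_betw[of _ UNIV UNIV f] by auto
  then show "(\<lambda>z. f (z - a)) summable_on S" "(\<lambda>z. f (a - z)) summable_on S"
    by (auto intro: summable_on_subset)
qed

section \<open>Poisson transition probabilities of the dual walk\<close>

lemma walk_row_finite_ctmc:
  assumes "ctmc S (walk_intensity w) P Y" and down: "\<And>z. z \<in> S \<Longrightarrow> z - 1 \<in> S"
  shows "row_finite_ctmc S (walk_intensity w) P Y (\<lambda>z. {z, z - 1})"
proof -
  interpret ctmc S "walk_intensity w" P Y by fact
  show ?thesis
    by unfold_locales (use down in \<open>auto simp: walk_intensity_def\<close>)
qed

text \<open>Poisson weights in the distance travelled start from the point mass at \<open>x\<close>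
  and solve the forward equation, so \<open>forward_equation_unique\<close> applies. A downward
  closed \<open>S\<close> covers the whole line and the half-line at once.\<close>

lemma walk_trans_prob:
  assumes walk: "ctmc S (walk_intensity w) P Y" and w: "0 \<le> w"
    and down: "\<And>x z. z \<in> S \<Longrightarrow> x \<le> z \<Longrightarrow> x \<in> S"
    and xy: "x \<in> S" "y \<in> S" and t: "0 \<le> t"
  shows "trans_prob P Y t x y = poisson_weight (x - y) (w * t)"
proof -
  interpret row_finite_ctmc S "walk_intensity w" P Y "\<lambda>z. {z, z - 1}"
    using walk by (rule walk_row_finite_ctmc) (rule down, auto)
  let ?b = "\<lambda>k. poisson_bound (w * t) k"
  have wt: "0 \<le> w * t" using w t by simp
  note sb = summable_on_int_affine(2)[OF poisson_bound_summable[OF wt]]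
  have sb1: "(\<lambda>z. ?b (x - z - j)) summable_on S" for j
    using sb[of "x - j" S] by (simp add: algebra_simps)
  have ws: "0 \<le> w * s \<and> w * s \<le> w * t" if "0 \<le> s" "s \<le> t" for s
    using w that by (auto intro: mult_left_mono)
  have "(\<Sum>\<^sub>\<infinity>z\<in>S. poisson_weight (x - z) (w * 0) * p t z y) = poisson_weight (x - y) (w * t)"
  proof (rule forward_equation_unique[where H = "\<lambda>z. ?b (x - z)"
        and g = "\<lambda>s z. w * (poisson_weight (x - z - 1) (w * s) - poisson_weight (x - z) (w * s))"
        and K = "\<lambda>z. w * (?b (x - z - 1) + ?b (x - z))"
        and G = "\<lambda>z. w\<^sup>2 * (?b (x - z - 2) + 2 * ?b (x - z - 1) + ?b (x - z))"])
    fix s z assume s: "0 \<le> s" "s \<le> t"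
    note ws = ws[OF s]
    note bds = poisson_weight_nonneg[OF conjunct1[OF ws]]
      poisson_weight_le_bound[OF conjunct1[OF ws] conjunct2[OF ws]]
    show "0 \<le> poisson_weight (x - z) (w * s)" "poisson_weight (x - z) (w * s) \<le> ?b (x - z)"
      by (rule bds)+
    have "\<bar>poisson_weight (x - z - 1) (w * s) - poisson_weight (x - z) (w * s)\<bar> \<le> ?b (x - z - 1) + ?b (x - z)"
      using bds[of "x - z - 1"] bds[of "x - z"] by linarith
    then show "\<bar>w * (poisson_weight (x - z - 1) (w * s) - poisson_weight (x - z) (w * s))\<bar>
        \<le> w * (?b (x - z - 1) + ?b (x - z))"
      using w by (simp add: abs_mult mult_left_mono)
  next
    show "(\<lambda>z. ?b (x - z)) summable_on S" by (rule sb)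
    then show "(\<lambda>z. ?b (x - z) * - walk_intensity w z z) summable_on S"
      by (simp add: walk_intensity_def summable_on_cmult_left)
    show "(\<lambda>z. w\<^sup>2 * (?b (x - z - 2) + 2 * ?b (x - z - 1) + ?b (x - z))) summable_on S"
      "(\<lambda>z. w * (?b (x - z - 1) + ?b (x - z))) summable_on S"
      by (intro summable_on_cmult_right summable_on_add sb sb1)+
  next
    fix s d z assume "0 \<le> s" "0 \<le> d" "s + d \<le> t"
    then show "\<bar>poisson_weight (x - z) (w * (s + d)) - poisson_weight (x - z) (w * s)
        - d * (w * (poisson_weight (x - z - 1) (w * s) - poisson_weight (x - z) (w * s)))\<bar>
      \<le> d\<^sup>2 * (w\<^sup>2 * (?b (x - z - 2) + 2 * ?b (x - z - 1) + ?b (x - z)))"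
      using poisson_weight_taylor[OF w, of s d t "x - z"] by simp
  next
    fix s :: real and u :: "int \<Rightarrow> real"
    assume s: "0 \<le> s" "s \<le> t" and u: "\<And>z. z \<in> S \<Longrightarrow> 0 \<le> u z \<and> u z \<le> 1"
    note ws = ws[OF s]
    define h where "h z = poisson_weight (x - z) (w * s)" for z
    have bd: "\<bar>h (z + j) * v\<bar> \<le> ?b (x - z - j)" if "0 \<le> v \<and> v \<le> 1" for z j v
    proof -
      have h: "0 \<le> h (z + j)" "h (z + j) \<le> ?b (x - z - j)"
        using poisson_weight_nonneg[of "w * s" "x - z - j"]
          poisson_weight_le_bound[of "w * s" "w * t" "x - z - j"] ws
        by (simp_all add: h_def diff_diff_eq)
      have "h (z + j) * v \<le> h (z + j)" using h that by (simp add: mult_left_le)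
      then show ?thesis using h that by simp
    qed
    have s1: "(\<lambda>z. h z * u z) summable_on S"
      by (rule summable_on_dominated[OF sb1[of 0]]) (use bd[of _ _ 0] u in auto)
    have s2: "(\<lambda>z. h z * u (z - 1)) summable_on S"
      by (rule summable_on_dominated[OF sb1[of 0]]) (use bd[of _ _ 0] u down in auto)
    have s3: "(\<lambda>z. h (z + 1) * u z) summable_on S"
      by (rule summable_on_dominated[OF sb1[of 1]]) (use bd[of _ _ 1] u in auto)
    have "(\<Sum>\<^sub>\<infinity>z\<in>S. h z * u (z - 1)) = (\<Sum>\<^sub>\<infinity>z\<in>{z\<in>S. z + 1 \<in> S}. h (z + 1) * u z)"
      by (rule infsum_reindex_bij_witness[where i = "\<lambda>z. z + 1" and j = "\<lambda>z. z - 1"])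
        (auto intro: down)
    also have "\<dots> = (\<Sum>\<^sub>\<infinity>z\<in>S. h (z + 1) * u z)"
    proof (rule infsum_cong_neutral)
      \<comment> \<open>If \<open>z\<close> is in \<open>S\<close> but \<open>z + 1\<close> is not,
        downward closure puts \<open>x\<close> below \<open>z + 1\<close>, where the Poisson weight
        has a negative index and vanishes.\<close>
      fix z assume "z \<in> S - {z \<in> S. z + 1 \<in> S}"
      then have "x < z + 1" using down[OF xy(1), of "z + 1"] by force
      then show "h (z + 1) * u z = 0" by (simp add: h_def poisson_weight_def)
    qed auto
    finally have shift: "(\<Sum>\<^sub>\<infinity>z\<in>S. h z * u (z - 1)) = (\<Sum>\<^sub>\<infinity>z\<in>S. h (z + 1) * u z)" .
    have "(\<Sum>\<^sub>\<infinity>z\<in>S. h z * (\<Sum>y\<in>{z, z - 1}. walk_intensity w z y * u y))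
        = (\<Sum>\<^sub>\<infinity>z\<in>S. w * (h z * u (z - 1) - h z * u z))"
      by (rule infsum_cong) (simp add: walk_intensity_def algebra_simps)
    also have "\<dots> = (\<Sum>\<^sub>\<infinity>z\<in>S. w * (h (z + 1) * u z - h z * u z))"
      using s1 s2 s3 shift by (simp add: infsum_cmult_right' infsum_diff)
    also have "\<dots> = (\<Sum>\<^sub>\<infinity>z\<in>S. w * (h (z + 1) - h z) * u z)"
      by (rule infsum_cong) (simp add: algebra_simps)
    finally show "(\<Sum>\<^sub>\<infinity>z\<in>S. poisson_weight (x - z) (w * s) * (\<Sum>y\<in>{z, z - 1}. walk_intensity w z y * u y))
      = (\<Sum>\<^sub>\<infinity>z\<in>S. w * (poisson_weight (x - z - 1) (w * s) - poisson_weight (x - z) (w * s)) * u z)"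
      by (simp add: h_def algebra_simps)
  qed (use xy t in auto)
  moreover have "(\<Sum>\<^sub>\<infinity>z\<in>S. poisson_weight (x - z) (w * 0) * p t z y) = (\<Sum>\<^sub>\<infinity>z\<in>{x}. p t x y)"
    by (rule infsum_cong_neutral) (use xy in \<open>auto simp: poisson_weight_0\<close>)
  ultimately show ?thesis by simp
qed

section \<open>Configurations\<close>

definition gap :: "int list \<Rightarrow> nat \<Rightarrow> nat" where
  "gap z i = nat (z ! Suc i - z ! i - 1)"

text \<open>The signed displacement makes a jump and its reversal instances of one
  operation.\<close>

definition move_by :: "int \<Rightarrow> nat \<Rightarrow> int list \<Rightarrow> int list" where
  "move_by a i z = z[i := z ! i + a]"

lemma configs_iff: "z \<in> configs N \<longleftrightarrow> length z = N \<and> (\<forall>i. Suc i < N \<longrightarrow> z ! i < z ! Suc i)"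
  by (auto simp: configs_def sorted_wrt_iff_nth_Suc_transp)

lemma move_by_move_by:
  assumes "i < length z"
  shows "move_by a i (move_by b i z) = move_by (a + b) i z"
  using assms by (simp add: move_by_def algebra_simps)

lemma move_by_zero: "move_by 0 i z = z"
  by (simp add: move_by_def)

lemma length_move_by [simp]: "length (move_by a i z) = length z"
  by (simp add: move_by_def)

lemma nth_move_by: "j < length z \<Longrightarrow> move_by a i z ! j = (if i = j then z ! j + a else z ! j)"
  by (simp add: move_by_def nth_list_update)

lemma move_by_1_config_iff:
  assumes "z \<in> configs N" "i < N"
  shows "move_by 1 i z \<in> configs N \<longleftrightarrow> (Suc i < N \<longrightarrow> 0 < gap z i)"
proof
  assume "move_by 1 i z \<in> configs N"
  then have "Suc i < N \<Longrightarrow> move_by 1 i z ! i < move_by 1 i z ! Suc i" by (simp add: configs_iff)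
  then show "Suc i < N \<longrightarrow> 0 < gap z i"
    using assms by (auto simp: nth_move_by gap_def configs_iff)
next
  assume a: "Suc i < N \<longrightarrow> 0 < gap z i"
  show "move_by 1 i z \<in> configs N"
    unfolding configs_iff
  proof (intro conjI allI impI)
    fix j assume "Suc j < N"
    moreover from this have "z ! j < z ! Suc j" using assms by (simp add: configs_iff)
    ultimately show "move_by 1 i z ! j < move_by 1 i z ! Suc j"
      using a assms by (auto simp: nth_move_by gap_def configs_iff)
  qed (use assms in \<open>simp add: configs_iff\<close>)
qed

lemma move_by_minus_1_config_iff:
  assumes "z \<in> configs N" "i < N"
  shows "move_by (-1) i z \<in> configs N \<longleftrightarrow> (0 < i \<longrightarrow> 0 < gap z (i - 1))"
proof
  assume s: "move_by (-1) i z \<in> configs N"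
  show "0 < i \<longrightarrow> 0 < gap z (i - 1)"
  proof
    assume "0 < i"
    then obtain j where j: "i = Suc j" by (cases i) auto
    then have "move_by (-1) i z ! j < move_by (-1) i z ! Suc j" using s assms by (simp add: configs_iff)
    then show "0 < gap z (i - 1)" using assms j by (simp add: nth_move_by gap_def configs_iff)
  qed
next
  assume a: "0 < i \<longrightarrow> 0 < gap z (i - 1)"
  show "move_by (-1) i z \<in> configs N"
    unfolding configs_iff
  proof (intro conjI allI impI)
    fix j assume "Suc j < N"
    moreover from this have "z ! j < z ! Suc j" using assms by (simp add: configs_iff)
    ultimately show "move_by (-1) i z ! j < move_by (-1) i z ! Suc j"
      using a assms by (auto simp: nth_move_by gap_def configs_iff)
  qed (use assms in \<open>simp add: configs_iff\<close>)
qed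

lemma gap_move_by_minus_1:
  assumes "z \<in> configs N" "i < N" "move_by (-1) i z \<in> configs N" "Suc k < N"
  shows "gap (move_by (-1) i z) k = (if k = i then gap z k + 1 else if Suc k = i then gap z k - 1 else gap z k)"
proof -
  have "z ! k < z ! Suc k" using assms by (simp add: configs_iff)
  then show ?thesis using assms by (auto simp: gap_def nth_move_by configs_iff nat_add_distrib[symmetric] nat_diff_distrib[symmetric])
qed

text \<open>Change of variables: moving particle \<open>i\<close> is a bijection from the
  configurations where the forward move is legal onto those where the backward move is.
  \<open>f\<close> and \<open>f'\<close> vanish elsewhere, so both sums extend to all
  configurations.\<close>

lemma infsum_configs_move_by:
  fixes f f' u :: "int list \<Rightarrow> real"
  assumes i: "i < N"
    and f: "\<And>z. z \<in> configs N \<Longrightarrow> move_by 1 i z \<notin> configs N \<Longrightarrow> f z = 0"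
    and f': "\<And>z. z \<in> configs N \<Longrightarrow> move_by (-1) i z \<notin> configs N \<Longrightarrow> f' z = 0"
    and eq: "\<And>z. z \<in> configs N \<Longrightarrow> move_by (-1) i z \<in> configs N \<Longrightarrow> f (move_by (-1) i z) = f' z"
  shows "(\<Sum>\<^sub>\<infinity>z\<in>configs N. f z * u (move_by 1 i z)) = (\<Sum>\<^sub>\<infinity>z\<in>configs N. f' z * u z)"
proof -
  have len: "length z = N" if "z \<in> configs N" for z using that by (simp add: configs_def)
  have "(\<Sum>\<^sub>\<infinity>z\<in>configs N. f z * u (move_by 1 i z))
      = (\<Sum>\<^sub>\<infinity>z\<in>{z\<in>configs N. move_by 1 i z \<in> configs N}. f z * u (move_by 1 i z))"
    by (rule infsum_cong_neutral) (auto simp: f)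
  also have "\<dots> = (\<Sum>\<^sub>\<infinity>z\<in>{z\<in>configs N. move_by (-1) i z \<in> configs N}. f' z * u z)"
  proof (rule infsum_reindex_bij_witness[where i = "move_by (-1) i" and j = "move_by 1 i"])
    fix z assume z: "z \<in> {z \<in> configs N. move_by 1 i z \<in> configs N}"
    then have *: "move_by (-1) i (move_by 1 i z) = z"
      using i by (simp add: move_by_move_by len move_by_zero)
    show "move_by (-1) i (move_by 1 i z) = z" by (rule *)
    show "move_by 1 i z \<in> {z \<in> configs N. move_by (-1) i z \<in> configs N}"
      using z * by simp
    show "f' (move_by 1 i z) * u (move_by 1 i z) = f z * u (move_by 1 i z)"
      using z * eq[of "move_by 1 i z"] by simp
  next
    fix z assume z: "z \<in> {z \<in> configs N. move_by (-1) i z \<in> configs N}"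
    then have *: "move_by 1 i (move_by (-1) i z) = z"
      using i by (simp add: move_by_move_by len move_by_zero)
    show "move_by 1 i (move_by (-1) i z) = z" by (rule *)
    show "move_by (-1) i z \<in> {z \<in> configs N. move_by 1 i z \<in> configs N}"
      using z * by simp
  qed
  also have "\<dots> = (\<Sum>\<^sub>\<infinity>z\<in>configs N. f' z * u z)"
    by (rule infsum_cong_neutral) (auto simp: f')
  finally show ?thesis .
qed

text \<open>A configuration of \<open>N + 1\<close> particles is one of \<open>N\<close> particles
  together with one more headway, so by induction the sum factorizes over the first position and the
  headways.\<close>

lemma configs_summable:
  fixes b :: "int \<Rightarrow> real" and a :: "nat \<Rightarrow> nat \<Rightarrow> real"
  assumes N: "1 \<le> N" and b: "b summable_on UNIV" "\<And>k. 0 \<le> b k"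
    and a: "\<And>i. a i summable_on UNIV" "\<And>i n. 0 \<le> a i n"
  shows "(\<lambda>z. b (z ! 0) * (\<Prod>i<N - 1. a i (gap z i))) summable_on configs N"
  using N
proof (induction N rule: nat_induct_at_least)
  case base
  have "b summable_on UNIV \<longleftrightarrow>
      (\<lambda>z. b (z ! 0) * (\<Prod>i<1 - 1. a i (gap z i))) summable_on configs 1"
    by (rule summable_on_reindex_bij_witness[where i = "\<lambda>z. z ! 0" and j = "\<lambda>k. [k]"])
      (auto simp: configs_def length_Suc_conv)
  then show ?case using b by blast
next
  case (Suc N)
  define F where "F z = b (z ! 0) * (\<Prod>i<N - 1. a i (gap z i))" for z
  have "(\<lambda>(z, n). F z * a (N - 1) n) summable_on (configs N \<times> UNIV)"
  proof (rule summable_on_SigmaI[where g = "\<lambda>z. F z * infsum (a (N - 1)) UNIV"])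
    show "((\<lambda>n. case (z, n) of (z, n) \<Rightarrow> F z * a (N - 1) n) has_sum F z * infsum (a (N - 1)) UNIV) UNIV" for z
      by (simp add: has_sum_cmult_right has_sum_infsum a)
    show "(\<lambda>z. F z * infsum (a (N - 1)) UNIV) summable_on configs N"
      using Suc.IH unfolding F_def by (rule summable_on_cmult_left)
    show "0 \<le> (case (z, n) of (z, n) \<Rightarrow> F z * a (N - 1) n)" for z n
      by (auto simp: F_def intro!: mult_nonneg_nonneg prod_nonneg b a)
  qed
  moreover have "(\<lambda>(z, n). F z * a (N - 1) n) summable_on (configs N \<times> UNIV) \<longleftrightarrow>
      (\<lambda>z. b (z ! 0) * (\<Prod>i<Suc N - 1. a i (gap z i))) summable_on configs (Suc N)"
  proof (rule summable_on_reindex_bij_witness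
      [where i = "\<lambda>x. (take N x, gap x (N - 1))" and j = "\<lambda>(z, n). z @ [z ! (N - 1) + 1 + int n]"])
    fix zn assume "zn \<in> configs N \<times> (UNIV :: nat set)"
    then obtain z n where zn: "zn = (z, n)" and z: "z \<in> configs N" by auto
    let ?x = "z @ [z ! (N - 1) + 1 + int n]"
    have len: "length z = N" using z by (simp add: configs_def)
    have g: "gap ?x (N - 1) = n" using Suc.hyps len by (simp add: gap_def nth_append)
    have g': "gap ?x i = gap z i" if "i < N - 1" for i
      using that len by (simp add: gap_def nth_append)
    show "(case (case zn of (z, n) \<Rightarrow> z @ [z ! (N - 1) + 1 + int n]) of x \<Rightarrow> (take N x, gap x (N - 1))) = zn"
      using g len zn by simp
    have "Suc i < Suc N \<Longrightarrow> ?x ! i < ?x ! Suc i" for i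
      using z Suc.hyps by (cases "Suc i = N") (auto simp: configs_iff nth_append)
    then show "(case zn of (z, n) \<Rightarrow> z @ [z ! (N - 1) + 1 + int n]) \<in> configs (Suc N)"
      using zn len by (simp add: configs_iff)
    \<comment> \<open>The appended particle creates the headway with index \<open>N - 1\<close>; all
      earlier ones are unchanged.\<close>
    have "{..<Suc N - 1} = insert (N - 1) {..<N - 1}" using Suc.hyps by auto
    then have "(\<Prod>i<Suc N - 1. a i (gap ?x i)) = a (N - 1) n * (\<Prod>i<N - 1. a i (gap z i))"
      by (simp only:) (simp add: g[simplified] g'[simplified])
    then show "(b ((case zn of (z, n) \<Rightarrow> z @ [z ! (N - 1) + 1 + int n]) ! 0)
        * (\<Prod>i<Suc N - 1. a i (gap (case zn of (z, n) \<Rightarrow> z @ [z ! (N - 1) + 1 + int n]) i)))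
        = (case zn of (z, n) \<Rightarrow> F z * a (N - 1) n)"
      using zn len Suc.hyps by (simp add: F_def nth_append)
  next
    fix x assume x: "x \<in> configs (Suc N)"
    then have len: "length x = Suc N" by (simp add: configs_def)
    have "x ! (N - 1) < x ! N"
      using x Suc.hyps unfolding configs_iff by (metis Suc_pred' less_Suc_eq Suc_le_eq One_nat_def)
    then have "take N x ! (N - 1) + 1 + int (gap x (N - 1)) = x ! N"
      using Suc.hyps by (simp add: gap_def)
    then show "(case (take N x, gap x (N - 1)) of (z, n) \<Rightarrow> z @ [z ! (N - 1) + 1 + int n]) = x"
      using len take_Suc_conv_app_nth[of N x] by simp
    show "(take N x, gap x (N - 1)) \<in> configs N \<times> UNIV"
      using x by (simp add: configs_iff)
  qed
  ultimately show ?case by blast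
qed

section \<open>The headway process\<close>

locale headway_process =
  fixes J :: "nat \<Rightarrow> ereal" and w :: real and N :: nat
  assumes N_pos: "1 \<le> N" and w_pos: "0 < w"
    and finite_rates: "\<And>k. rate_ratio J k < \<infinity>"
    and finite_Z: "partition_function J < \<infinity>"
begin

definition g :: "nat \<Rightarrow> real" where
  "g k = enn2real (rate_ratio J k)"

definition W :: "nat \<Rightarrow> real" where
  "W n = (\<Prod>k=1..n. inverse (g k))"

text \<open>The weight \<pi> of i.i.d. headways. The position of the leftmost particle does not
  enter, so multiplying by a function of \<open>z ! 0\<close> prescribes that position independently
  of the headways.\<close>

definition stat :: "int list \<Rightarrow> real" where
  "stat z = (\<Prod>i<N - 1. W (gap z i)) / enn2real (partition_function J) ^ (N - 1)"

definition rate :: "int list \<Rightarrow> nat \<Rightarrow> real" where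
  "rate z i = w * (if Suc i < N then g (gap z i) else 1)"

text \<open>
  Stationary weight times jump rate of particle \<open>i\<close>, headway by headway, using
  \<open>W n * g n = W (n - 1)\<close>. Moving particle \<open>i\<close> back one site turns it into \<open>tilted (i - 1)\<close>, which
  makes the forward equation telescope over the particles.
\<close>

definition tilted :: "nat \<Rightarrow> nat \<Rightarrow> nat \<Rightarrow> real" where
  "tilted i k n = (if k = i then if n = 0 then 0 else W (n - 1) else W n)"

section \<open>Positivity, summability and balance of the stationary weights\<close>

lemma ennreal_inverse_pos: "0 < inverse (rate_ratio J k)"
  using finite_rates[of k] by (simp add: ennreal_inverse_positive)

text \<open>A zero ratio at \<open>k\<close> would make one factor of the \<open>k\<close>-th term
  of the partition function infinite, while finite rates keep the other factors nonzero. That term,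
  and with it the whole sum, would be infinite.\<close>

lemma rate_ratio_pos:
  assumes "1 \<le> k"
  shows "0 < rate_ratio J k"
proof (rule ccontr)
  assume "\<not> 0 < rate_ratio J k"
  then have k: "inverse (rate_ratio J k) = \<infinity>" by simp
  have "(\<Prod>j\<in>{1..k} - {k}. inverse (rate_ratio J j)) \<noteq> 0"
    using ennreal_inverse_pos by (simp add: less_le)
  then have "(\<Prod>j=1..k. inverse (rate_ratio J j)) = \<infinity>"
    using assms by (subst prod.remove[of _ k]) (auto simp: k ennreal_top_mult)
  moreover have "(\<Prod>j=1..k. inverse (rate_ratio J j)) \<le> partition_function J"
    unfolding partition_function_def
    using sum_le_suminf[of "\<lambda>n. \<Prod>j=1..n. inverse (rate_ratio J j)" "{k}"] by simp
  ultimately show False using finite_Z by (simp add: top_unique)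
qed

lemma g_0: "g 0 = 0"
  by (simp add: g_def rate_ratio_0)

lemma g_pos: "1 \<le> k \<Longrightarrow> 0 < g k"
  using rate_ratio_pos finite_rates by (simp add: g_def enn2real_positive_iff)

lemma g_nonneg: "0 \<le> g k"
  by (simp add: g_def)

lemma W_nonneg: "0 \<le> W n"
  by (auto simp: W_def g_nonneg intro!: prod_nonneg)

lemma ennreal_W: "(\<Prod>k=1..n. inverse (rate_ratio J k)) = ennreal (W n)"
proof -
  have "inverse (rate_ratio J k) = ennreal (inverse (g k))" if "1 \<le> k" for k
    using finite_rates[of k] g_pos[OF that] by (simp add: g_def inverse_ennreal[symmetric])
  then show ?thesis
    by (simp add: W_def prod_ennreal g_nonneg)
qed

lemma W_summable: "summable W"
proof -
  have "(\<Sum>n. ennreal (W n)) \<noteq> top"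
    using finite_Z by (simp only: partition_function_def ennreal_W less_top infinity_ennreal_def)
  then show ?thesis by (intro summable_suminf_not_top) (auto simp: W_nonneg)
qed

lemma W_mult_g: "W n * g n = (if n = 0 then 0 else W (n - 1))"
proof (cases n)
  case (Suc m)
  then show ?thesis using g_pos[of n] by (simp add: W_def)
qed (simp add: g_0)

lemma tilted_nonneg: "0 \<le> tilted i k n"
  by (simp add: tilted_def W_nonneg)

text \<open>Tilting merely shifts \<open>W\<close> by one place. So \<open>W n * g n\<close> has the
  same sum as \<open>W\<close>, and the mean jump rate is finite even when \<open>g\<close> is
  unbounded.\<close>

lemma tilted_summable: "tilted i k summable_on UNIV"
proof (rule summable_nonneg_imp_summable_on)
  have "tilted i k (Suc n) = W (if k = i then n else Suc n)" for n by (simp add: tilted_def)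
  then have "summable (\<lambda>n. tilted i k (Suc n))"
    using W_summable summable_Suc_iff[of W] by (cases "k = i") auto
  then show "summable (tilted i k)" by (simp only: summable_Suc_iff)
qed (rule tilted_nonneg)

text \<open>The index \<open>N\<close> lies outside the product range, so no factor is
  tilted.\<close>

lemma stat_eq: "stat z = (\<Prod>k<N - 1. tilted N k (gap z k)) / enn2real (partition_function J) ^ (N - 1)"
  unfolding stat_def by (intro arg_cong2[where f = "(/)"] prod.cong) (auto simp: tilted_def)

lemma stat_mult_rate:
  assumes "i < N"
  shows "stat z * rate z i
    = w / enn2real (partition_function J) ^ (N - 1) * (\<Prod>k<N - 1. tilted i k (gap z k))"
proof -
  have "(\<Prod>k<N - 1. tilted i k (gap z k))
      = (\<Prod>k<N - 1. W (gap z k) * (if k = i then g (gap z k) else 1))"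
    by (intro prod.cong refl) (simp add: tilted_def W_mult_g)
  also have "\<dots> = (\<Prod>k<N - 1. W (gap z k)) * (if i < N - 1 then g (gap z i) else 1)"
    by (simp add: prod.distrib prod.delta)
  finally show ?thesis using assms by (auto simp: stat_def rate_def less_diff_conv)
qed

lemma stat_nonneg: "0 \<le> stat z"
  by (auto simp: stat_def W_nonneg intro!: prod_nonneg divide_nonneg_nonneg)

lemma rate_nonneg: "0 \<le> rate z i"
  using w_pos by (simp add: rate_def g_nonneg)

lemma stat_summable:
  assumes "b summable_on UNIV" "\<And>k. 0 \<le> b k"
  shows "(\<lambda>z. b (z ! 0) * stat z) summable_on configs N"
  using summable_on_cmult_left[OF configs_summable[where a = "tilted N", OF N_pos assms tilted_summable tilted_nonneg],
      of "inverse (enn2real (partition_function J) ^ (N - 1))"]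
  by (simp add: stat_eq divide_inverse mult_ac)

lemma stat_rate_summable:
  assumes "b summable_on UNIV" "\<And>k. 0 \<le> b k" "i < N"
  shows "(\<lambda>z. b (z ! 0) * (stat z * rate z i)) summable_on configs N"
  using summable_on_cmult_left[OF configs_summable[where a = "tilted i", OF N_pos assms(1,2) tilted_summable tilted_nonneg],
      of "w / enn2real (partition_function J) ^ (N - 1)"]
  by (simp add: stat_mult_rate[OF assms(3)] mult_ac)

lemma jump_rate_eq: "z \<in> configs N \<Longrightarrow> i < N \<Longrightarrow> jump_rate J w z i = rate z i"
  by (simp add: jump_rate_def headway_def rate_def configs_def gap_def g_def)

lemma rate_blocked:
  assumes "z \<in> configs N" "i < N" "move_by 1 i z \<notin> configs N"
  shows "rate z i = 0"
  using assms move_by_1_config_iff[OF assms(1,2)] by (auto simp: rate_def g_0)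

text \<open>Pairwise balance: the flow into \<open>z\<close> by a jump of particle \<open>i\<close>
  equals the flow out of \<open>z\<close> by particle \<open>i - 1\<close>. Moving \<open>i\<close>
  back enlarges the headway ahead of it by one, which cancels its tilt, and shrinks the headway
  behind it by one, which is the tilt at \<open>i - 1\<close>. For \<open>i = 0\<close> nothing lies
  behind, leaving \<open>w * stat z\<close>.\<close>

lemma stat_rate_move_by:
  assumes z: "z \<in> configs N" and i: "i < N" and s: "move_by (-1) i z \<in> configs N"
  shows "stat (move_by (-1) i z) * rate (move_by (-1) i z) i
    = (if i = 0 then w * stat z else stat z * rate z (i - 1))"
proof -
  have *: "tilted i k (gap (move_by (-1) i z) k) = (if i = 0 then tilted N k (gap z k) else tilted (i - 1) k (gap z k))"
    if "k < N - 1" for k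
  proof -
    have "0 < i \<Longrightarrow> 0 < gap z (i - 1)" using s move_by_minus_1_config_iff[OF z i] by simp
    then show ?thesis
      using gap_move_by_minus_1[OF z i s, of k] that by (auto simp: tilted_def)
  qed
  have "(\<Prod>k<N - 1. tilted i k (gap (move_by (-1) i z) k))
      = (\<Prod>k<N - 1. if i = 0 then tilted N k (gap z k) else tilted (i - 1) k (gap z k))"
    by (intro prod.cong refl) (simp add: *)
  moreover have "i - 1 < N" using i by simp
  ultimately show ?thesis
    using stat_mult_rate[OF i, of "move_by (-1) i z"] stat_mult_rate[of "i - 1" z] stat_eq[of z]
    by (cases "i = 0") (simp_all only: if_True if_False, simp)
qed

text \<open>Blocked jumps would leave \<open>configs N\<close> and are cut off; \<open>z\<close> is
  added for the diagonal entry.\<close>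

definition succs :: "int list \<Rightarrow> int list set" where
  "succs z = insert z ((\<lambda>i. move_by 1 i z) ` {..<N} \<inter> configs N)"

text \<open>The generator in its usual form. Targets missing from \<open>succs z\<close> are those
  of blocked particles, whose rate is \<open>w * g 0 = 0\<close>.\<close>

lemma sum_succs:
  assumes z: "z \<in> configs N"
  shows "(\<Sum>y\<in>succs z. tahep_intensity J w z y * u y) = (\<Sum>i<N. rate z i * (u (move_by 1 i z) - u z))"
proof -
  have fin: "finite (succs z)" and len: "length z = N" using z by (auto simp: succs_def configs_def)
  have "(\<Sum>y\<in>succs z. tahep_intensity J w z y * u y)
      = (\<Sum>y\<in>succs z. \<Sum>i<N. rate z i * (of_bool (y = move_by 1 i z) - of_bool (y = z)) * u y)"
    unfolding tahep_intensity_def sum_distrib_right len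
    by (intro sum.cong refl) (simp add: jump_rate_eq z move_by_def)
  also have "\<dots> = (\<Sum>i<N. \<Sum>y\<in>succs z. rate z i * (of_bool (y = move_by 1 i z) - of_bool (y = z)) * u y)"
    by (rule sum.swap)
  also have "\<dots> = (\<Sum>i<N. rate z i * (u (move_by 1 i z) - u z))"
  proof (rule sum.cong[OF refl])
    fix i assume i: "i \<in> {..<N}"
    have "z \<in> succs z" by (simp add: succs_def)
    then have "(\<Sum>y\<in>succs z. rate z i * (of_bool (y = move_by 1 i z) - of_bool (y = z)) * u y)
        = rate z i * ((if move_by 1 i z \<in> succs z then u (move_by 1 i z) else 0) - u z)"
      using fin by (simp add: algebra_simps sum_subtractf of_bool_def if_distrib[of "\<lambda>c. c * _"]
          if_distrib[of "\<lambda>c. _ * c"] cong: if_cong)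
    moreover have "rate z i = 0" if "move_by 1 i z \<notin> succs z"
      using that i z by (intro rate_blocked) (auto simp: succs_def)
    ultimately show "(\<Sum>y\<in>succs z. rate z i * (of_bool (y = move_by 1 i z) - of_bool (y = z)) * u y)
        = rate z i * (u (move_by 1 i z) - u z)"
      by auto
  qed
  finally show ?thesis .
qed

section \<open>Forward equation of the exclusion process and duality\<close>

lemma tahep_row_finite_ctmc:
  assumes "ctmc (configs N) (tahep_intensity J w) P X"
  shows "row_finite_ctmc (configs N) (tahep_intensity J w) P X succs"
proof -
  interpret ctmc "configs N" "tahep_intensity J w" P X by fact
  show ?thesis
    using sum_succs[where u = "\<lambda>_. 1"] by unfold_locales (auto simp: succs_def)
qed

lemma tahep_exit_rate:
  assumes z: "z \<in> configs N"
  shows "- tahep_intensity J w z z = (\<Sum>i<N. rate z i)"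
proof -
  have "z \<noteq> z[i := z ! i + 1]" if "i < N" for i
    using z that by (auto simp: configs_def dest!: arg_cong[where f = "\<lambda>z. z ! i"])
  then show ?thesis
    unfolding tahep_intensity_def sum_negf[symmetric]
    using z by (intro sum.cong) (auto simp: jump_rate_eq configs_def)
qed

text \<open>\<open>T i\<close> is the gain and \<open>U i\<close> the loss through jumps of particle
  \<open>i\<close>, tested against \<open>u\<close>. Balance gives \<open>T (Suc i) = U i\<close>,
  so the sum telescopes to \<open>T 0 - U (N - 1)\<close>: the first term is \<open>w\<close> times
  the weight shifted by one site, the second is \<open>w\<close> times the weight itself, since the
  rightmost particle jumps at rate \<open>w\<close>.\<close>

lemma weak_forward_equation:
  fixes b :: "int \<Rightarrow> real"
  assumes b: "b summable_on UNIV" "\<And>k. 0 \<le> b k"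
    and u: "\<And>z. z \<in> configs N \<Longrightarrow> 0 \<le> u z \<and> u z \<le> 1"
  shows "(\<Sum>\<^sub>\<infinity>z\<in>configs N. b (z ! 0) * stat z * (\<Sum>y\<in>succs z. tahep_intensity J w z y * u y))
    = (\<Sum>\<^sub>\<infinity>z\<in>configs N. w * (b (z ! 0 - 1) - b (z ! 0)) * stat z * u z)"
proof -
  define f where "f i z = b (z ! 0) * (stat z * rate z i)" for i z
  define T where "T i = (\<Sum>\<^sub>\<infinity>z\<in>configs N. f i z * u (move_by 1 i z))" for i
  define U where "U i = (\<Sum>\<^sub>\<infinity>z\<in>configs N. f i z * u z)" for i
  have f0: "0 \<le> f i z" for i z by (simp add: f_def b stat_nonneg rate_nonneg)
  have fs: "f i summable_on configs N" if "i < N" for i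
    unfolding f_def by (rule stat_rate_summable[OF b that])
  have sU: "(\<lambda>z. f i z * u z) summable_on configs N" if "i < N" for i
    by (rule summable_on_dominated[OF fs[OF that]])
      (use u f0 in \<open>auto simp: abs_mult mult_left_le\<close>)
  have sT: "(\<lambda>z. f i z * u (move_by 1 i z)) summable_on configs N" if "i < N" for i
  proof (rule summable_on_dominated[OF fs[OF that]])
    fix z assume z: "z \<in> configs N"
    show "\<bar>f i z * u (move_by 1 i z)\<bar> \<le> f i z"
    \<comment> \<open>\<open>u\<close> is controlled only on configurations; off them the blocked
      rate is \<open>0\<close>.\<close>
    proof (cases "move_by 1 i z \<in> configs N")
      case True
      then show ?thesis using u[OF True] f0[of i z] by (auto simp: abs_mult mult_left_le)
    next
      case False
      then show ?thesis using rate_blocked[OF z that] by (simp add: f_def)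
    qed
  qed
  have T_Suc: "T (Suc i) = U i" if "Suc i < N" for i
    unfolding T_def U_def
  proof (rule infsum_configs_move_by[OF that])
    fix z assume z: "z \<in> configs N"
    show "f (Suc i) z = 0" if "move_by 1 (Suc i) z \<notin> configs N"
      using rate_blocked[OF z \<open>Suc i < N\<close> that] by (simp add: f_def)
    show "f i z = 0" if "move_by (-1) (Suc i) z \<notin> configs N"
      \<comment> \<open>An illegal backward move of particle \<open>i + 1\<close> means headway
        \<open>0\<close> for particle \<open>i\<close>, whose rate then contains
        \<open>g 0 = 0\<close>.\<close>
      using move_by_minus_1_config_iff[OF z \<open>Suc i < N\<close>] that \<open>Suc i < N\<close>
      by (simp add: f_def rate_def g_0)
    show "f (Suc i) (move_by (-1) (Suc i) z) = f i z" if "move_by (-1) (Suc i) z \<in> configs N"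
      using stat_rate_move_by[OF z \<open>Suc i < N\<close> that] z \<open>Suc i < N\<close>
      by (simp add: f_def nth_move_by configs_def)
  qed
  have T_0: "T 0 = (\<Sum>\<^sub>\<infinity>z\<in>configs N. w * (b (z ! 0 - 1) * stat z) * u z)"
    unfolding T_def
  proof (rule infsum_configs_move_by)
    show "0 < N" using N_pos by simp
    fix z assume z: "z \<in> configs N"
    show "f 0 z = 0" if "move_by 1 0 z \<notin> configs N"
      using rate_blocked[OF z \<open>0 < N\<close> that] by (simp add: f_def)
    show "w * (b (z ! 0 - 1) * stat z) = 0" if "move_by (-1) 0 z \<notin> configs N"
      using move_by_minus_1_config_iff[OF z \<open>0 < N\<close>] that by simp
    show "f 0 (move_by (-1) 0 z) = w * (b (z ! 0 - 1) * stat z)" if "move_by (-1) 0 z \<in> configs N"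
      using stat_rate_move_by[OF z \<open>0 < N\<close> that] z \<open>0 < N\<close>
      by (simp add: f_def nth_move_by configs_def)
  qed
  have U_last: "U (N - 1) = (\<Sum>\<^sub>\<infinity>z\<in>configs N. w * (b (z ! 0) * stat z) * u z)"
    unfolding U_def f_def rate_def using N_pos by (simp add: mult_ac)
  have bs: "(\<lambda>k. b (k - 1)) summable_on UNIV" by (rule summable_on_int_affine(1)[OF b(1)])
  have s_b: "(\<lambda>z. w * (c (z ! 0) * stat z) * u z) summable_on configs N"
    if c: "c summable_on UNIV" "\<And>k. 0 \<le> c k" for c :: "int \<Rightarrow> real"
    by (rule summable_on_dominated[OF summable_on_cmult_right[OF stat_summable[OF c], of w]])
      (use u c stat_nonneg w_pos in \<open>auto simp: abs_mult mult_left_le\<close>)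
  have "(\<Sum>\<^sub>\<infinity>z\<in>configs N. b (z ! 0) * stat z * (\<Sum>y\<in>succs z. tahep_intensity J w z y * u y))
      = (\<Sum>\<^sub>\<infinity>z\<in>configs N. \<Sum>i<N. f i z * u (move_by 1 i z) - f i z * u z)"
    by (rule infsum_cong, subst sum_succs) (simp_all add: sum_distrib_left f_def algebra_simps)
  also have "\<dots> = (\<Sum>i<N. \<Sum>\<^sub>\<infinity>z\<in>configs N. f i z * u (move_by 1 i z) - f i z * u z)"
    by (rule infsum_sum) (auto intro: summable_on_diff sT sU)
  also have "\<dots> = (\<Sum>i<N. T i - U i)"
    unfolding T_def U_def by (intro sum.cong refl infsum_diff sT sU) auto
  also have "\<dots> = T 0 - U (N - 1)"
  proof -
    obtain M where M: "N = Suc M" using N_pos by (cases N) auto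
    have "(\<Sum>i<N. T i) = T 0 + (\<Sum>i<M. T (Suc i))"
      unfolding M by (rule sum.lessThan_Suc_shift)
    also have "(\<Sum>i<M. T (Suc i)) = (\<Sum>i<M. U i)"
      using M by (intro sum.cong refl T_Suc) auto
    finally show ?thesis by (simp add: sum_subtractf M)
  qed
  also have "\<dots> = (\<Sum>\<^sub>\<infinity>z\<in>configs N. w * (b (z ! 0 - 1) * stat z) * u z - w * (b (z ! 0) * stat z) * u z)"
    unfolding T_0 U_last by (rule infsum_diff[symmetric]) (intro s_b bs b)+
  also have "\<dots> = (\<Sum>\<^sub>\<infinity>z\<in>configs N. w * (b (z ! 0 - 1) - b (z ! 0)) * stat z * u z)"
    by (rule infsum_cong) (simp add: algebra_simps)
  finally show ?thesis .
qed

lemma duality_fun_eq: "duality_fun J N y z = of_bool (z ! 0 = y) * stat z"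
  by (simp add: duality_fun_def stat_def W_def gap_def g_def)

text \<open>The product of a Poisson law for the leftmost particle and the stationary headway law
  starts at \<open>duality_fun J N y\<close> and solves the weak forward equation, so uniqueness
  identifies it with the evolved initial weight.\<close>

lemma tahep_evolution:
  assumes tahep: "ctmc (configs N) (tahep_intensity J w) P X"
    and t: "0 \<le> t" and x: "x \<in> configs N"
  shows "(\<Sum>\<^sub>\<infinity>z\<in>configs N. duality_fun J N y z * trans_prob P X t z x)
    = poisson_weight (x ! 0 - y) (w * t) * stat x"
proof -
  interpret row_finite_ctmc "configs N" "tahep_intensity J w" P X succs
    by (rule tahep_row_finite_ctmc[OF tahep])
  let ?b = "\<lambda>k. poisson_bound (w * t) k"
  have wt: "0 \<le> w * t" using w_pos t by simp
  have b0: "0 \<le> ?b k" for k using wt by (simp add: poisson_bound_def)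
  have sb: "(\<lambda>k. ?b (k - y - j)) summable_on UNIV" for j
    using summable_on_int_affine(1)[OF poisson_bound_summable[OF wt], of "y + j" UNIV]
    by (simp add: algebra_simps)
  have sb0: "(\<lambda>k. ?b (k - y)) summable_on UNIV" using sb[of 0] by simp
  have ws: "0 \<le> w * s \<and> w * s \<le> w * t" if "0 \<le> s" "s \<le> t" for s
    using w_pos that by (auto intro: mult_left_mono)
  have "(\<Sum>\<^sub>\<infinity>z\<in>configs N. poisson_weight (z ! 0 - y) (w * 0) * stat z * p t z x)
      = poisson_weight (x ! 0 - y) (w * t) * stat x"
  proof (rule forward_equation_unique[where H = "\<lambda>z. ?b (z ! 0 - y) * stat z"
        and g = "\<lambda>s z. w * (poisson_weight (z ! 0 - y - 1) (w * s) - poisson_weight (z ! 0 - y) (w * s)) * stat z"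
        and K = "\<lambda>z. w * (?b (z ! 0 - y - 1) + ?b (z ! 0 - y)) * stat z"
        and G = "\<lambda>z. w\<^sup>2 * (?b (z ! 0 - y - 2) + 2 * ?b (z ! 0 - y - 1) + ?b (z ! 0 - y)) * stat z"])
    fix s z assume s: "0 \<le> s" "s \<le> t"
    note ws = ws[OF s]
    note bds = poisson_weight_nonneg[OF conjunct1[OF ws]]
      poisson_weight_le_bound[OF conjunct1[OF ws] conjunct2[OF ws]]
    show "0 \<le> poisson_weight (z ! 0 - y) (w * s) * stat z"
      "poisson_weight (z ! 0 - y) (w * s) * stat z \<le> ?b (z ! 0 - y) * stat z"
      by (intro mult_nonneg_nonneg mult_right_mono bds stat_nonneg)+
    have "\<bar>poisson_weight (z ! 0 - y - 1) (w * s) - poisson_weight (z ! 0 - y) (w * s)\<bar>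
        \<le> ?b (z ! 0 - y - 1) + ?b (z ! 0 - y)"
      using bds[of "z ! 0 - y - 1"] bds[of "z ! 0 - y"] by linarith
    then show "\<bar>w * (poisson_weight (z ! 0 - y - 1) (w * s) - poisson_weight (z ! 0 - y) (w * s)) * stat z\<bar>
        \<le> w * (?b (z ! 0 - y - 1) + ?b (z ! 0 - y)) * stat z"
      using w_pos stat_nonneg by (simp add: abs_mult mult_left_mono mult_right_mono)
  next
    show "(\<lambda>z. ?b (z ! 0 - y) * stat z) summable_on configs N"
      by (intro stat_summable sb0 b0)
    \<comment> \<open>The mean exit rate under the majorant is a sum of \<open>N\<close> finite mean
      jump rates; this is the condition that replaces bounded rates.\<close>
    have "(\<lambda>z. \<Sum>i<N. ?b (z ! 0 - y) * (stat z * rate z i)) summable_on configs N"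
      by (rule summable_on_sum) (intro stat_rate_summable[OF sb0 b0], simp)
    then show "(\<lambda>z. ?b (z ! 0 - y) * stat z * - tahep_intensity J w z z) summable_on configs N"
      by (simp only: tahep_exit_rate sum_distrib_left mult.assoc cong: summable_on_cong)
    show "(\<lambda>z. w\<^sup>2 * (?b (z ! 0 - y - 2) + 2 * ?b (z ! 0 - y - 1) + ?b (z ! 0 - y)) * stat z) summable_on configs N"
      "(\<lambda>z. w * (?b (z ! 0 - y - 1) + ?b (z ! 0 - y)) * stat z) summable_on configs N"
      using w_pos by (intro stat_summable summable_on_cmult_right summable_on_add sb sb0
          add_nonneg_nonneg mult_nonneg_nonneg b0; simp)+
  next
    fix s d z assume "0 \<le> s" "0 \<le> d" "s + d \<le> t"
    then have "\<bar>poisson_weight (z ! 0 - y) (w * (s + d)) - poisson_weight (z ! 0 - y) (w * s)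
        - d * (w * (poisson_weight (z ! 0 - y - 1) (w * s) - poisson_weight (z ! 0 - y) (w * s)))\<bar> * stat z
      \<le> d\<^sup>2 * (w\<^sup>2 * (?b (z ! 0 - y - 2) + 2 * ?b (z ! 0 - y - 1) + ?b (z ! 0 - y))) * stat z"
      using w_pos by (intro mult_right_mono poisson_weight_taylor stat_nonneg) auto
    then have "\<bar>(poisson_weight (z ! 0 - y) (w * (s + d)) - poisson_weight (z ! 0 - y) (w * s)
        - d * (w * (poisson_weight (z ! 0 - y - 1) (w * s) - poisson_weight (z ! 0 - y) (w * s)))) * stat z\<bar>
      \<le> d\<^sup>2 * (w\<^sup>2 * (?b (z ! 0 - y - 2) + 2 * ?b (z ! 0 - y - 1) + ?b (z ! 0 - y))) * stat z"
      by (simp only: abs_mult abs_of_nonneg[OF stat_nonneg])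
    then show "\<bar>poisson_weight (z ! 0 - y) (w * (s + d)) * stat z - poisson_weight (z ! 0 - y) (w * s) * stat z
        - d * (w * (poisson_weight (z ! 0 - y - 1) (w * s) - poisson_weight (z ! 0 - y) (w * s)) * stat z)\<bar>
      \<le> d\<^sup>2 * (w\<^sup>2 * (?b (z ! 0 - y - 2) + 2 * ?b (z ! 0 - y - 1) + ?b (z ! 0 - y)) * stat z)"
      by (simp only: left_diff_distrib mult.assoc)
  next
    fix s :: real and u :: "int list \<Rightarrow> real"
    assume s: "0 \<le> s" "s \<le> t" and u: "\<And>z. z \<in> configs N \<Longrightarrow> 0 \<le> u z \<and> u z \<le> 1"
    note ws = ws[OF s]
    have "(\<lambda>k. poisson_weight (k - y) (w * s)) summable_on UNIV"
      using poisson_weight_nonneg poisson_weight_le_bound ws by (intro summable_on_comparison_test[OF sb0]) auto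
    then show "(\<Sum>\<^sub>\<infinity>z\<in>configs N. poisson_weight (z ! 0 - y) (w * s) * stat z
          * (\<Sum>y\<in>succs z. tahep_intensity J w z y * u y))
        = (\<Sum>\<^sub>\<infinity>z\<in>configs N. w * (poisson_weight (z ! 0 - y - 1) (w * s) - poisson_weight (z ! 0 - y) (w * s))
          * stat z * u z)"
      using weak_forward_equation[of "\<lambda>k. poisson_weight (k - y) (w * s)" u] u ws
      by (simp add: poisson_weight_nonneg diff_diff_eq add.commute)
  qed (use x t in auto)
  then show ?thesis
    by (simp add: duality_fun_eq poisson_weight_0)
qed

text \<open>The dual sum has the single nonzero term \<open>y' = x ! 0\<close>, present because this
  site lies in \<open>S\<close>. Moving left from \<open>x ! 0\<close> to \<open>y\<close> has the
  same Poisson weight as the leftmost particle moving right from \<open>y\<close> to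
  \<open>x ! 0\<close>.\<close>

lemma duality_relation:
  assumes tahep: "ctmc (configs N) (tahep_intensity J w) P X"
    and walk: "ctmc S (walk_intensity w) P' Y"
    and down: "\<And>x z. z \<in> S \<Longrightarrow> x \<le> z \<Longrightarrow> x \<in> S"
    and t: "0 \<le> t" and x: "x \<in> configs N" "x ! 0 \<in> S" and y: "y \<in> S"
  shows "reverse_duality_relation (configs N) S (trans_prob P X) (trans_prob P' Y) (duality_fun J N) t x y"
proof -
  have "(\<Sum>\<^sub>\<infinity>y'\<in>S. duality_fun J N y' x * trans_prob P' Y t y' y)
      = (\<Sum>\<^sub>\<infinity>y'\<in>{x ! 0}. stat x * trans_prob P' Y t (x ! 0) y)"
    by (rule infsum_cong_neutral) (use x in \<open>auto simp: duality_fun_eq\<close>)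
  also have "\<dots> = poisson_weight (x ! 0 - y) (w * t) * stat x"
    using walk_trans_prob[OF walk less_imp_le[OF w_pos] down x(2) y t] by simp
  finally show ?thesis
    unfolding reverse_duality_relation_def tahep_evolution[OF tahep t x(1)] by simp
qed

end

theorem theorem4p5:
  fixes J :: "nat \<Rightarrow> ereal" and w :: real and N :: nat and xstar :: int
    and P :: "int list \<Rightarrow> 'a measure" and X :: "real \<Rightarrow> 'a \<Rightarrow> int list"
    and P\<^sub>Z :: "int \<Rightarrow> 'b measure" and Y\<^sub>Z :: "real \<Rightarrow> 'b \<Rightarrow> int"
    and P' :: "int \<Rightarrow> 'c measure" and Y :: "real \<Rightarrow> 'c \<Rightarrow> int"
  assumes "N \<ge> 1" and "w > 0"
    and "J 0 = \<infinity>" and "\<And>n. n \<ge> 1 \<Longrightarrow> J n \<noteq> -\<infinity>"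
    and finite_rates: "\<And>k. rate_ratio J k < \<infinity>"
    and finite_Z: "partition_function J < \<infinity>"
    and tahep: "ctmc (configs N) (tahep_intensity J w) P X"
    and walk_on_Z: "ctmc UNIV (walk_intensity w) P\<^sub>Z Y\<^sub>Z"
    and walk: "ctmc {..xstar} (walk_intensity w) P' Y"
  shows "reversely_dual (configs N) UNIV (trans_prob P X) (trans_prob P\<^sub>Z Y\<^sub>Z) (duality_fun J N) \<and>
    (\<forall>t\<ge>0. \<forall>x\<in>configs N. \<forall>y\<in>{..xstar}. x ! 0 \<le> xstar \<longrightarrow>
       reverse_duality_relation (configs N) {..xstar}
         (trans_prob P X) (trans_prob P' Y) (duality_fun J N) t x y)"
proof -
  interpret headway_process J w N
    by unfold_locales fact+
  have "(\<lambda>y. duality_fun J N y x) summable_on UNIV" for x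
    by (rule finite_nonzero_values_imp_summable_on, rule finite_subset[of _ "{x ! 0}"])
      (auto simp: duality_fun_eq)
  \<comment> \<open>Summability over configurations comes from \<open>stat_summable\<close> with a
    point mass at \<open>y\<close> for the leftmost particle.\<close>
  moreover have "(\<lambda>x. duality_fun J N y x) summable_on configs N" for y
    unfolding duality_fun_eq
  proof (rule stat_summable)
    show "(\<lambda>k. of_bool (k = y) :: real) summable_on UNIV"
      by (rule finite_nonzero_values_imp_summable_on, rule finite_subset[of _ "{y}"]) auto
  qed simp
  ultimately have "reversely_dual (configs N) UNIV (trans_prob P X) (trans_prob P\<^sub>Z Y\<^sub>Z) (duality_fun J N)"
    unfolding reversely_dual_def using duality_relation[OF tahep walk_on_Z] by blast
  then show ?thesis
    using duality_relation[OF tahep walk] by auto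
qed

end
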